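(* Let $A\in\mathbb{R}^{n\times n}$, $B_1\in\mathbb{R}^{n\times m_1}$, $B_2\in\mathbb{R}^{n\times m_2}$, $C_1\in\mathbb{R}^{p_1\times n}$, $D_{11}\in\mathbb{R}^{p_1\times m_1}$, $D_{12}\in\mathbb{R}^{p_1\times m_2}$. Let $\lambda_1,\dots,\lambda_r$ be invariant zeros with nonpositive real part of $(A,B_2,C_1,D_{12})$, with associated null vectors $(\eta_j,\xi_j)$, i.e. $$\begin{pmatrix}A-\lambda_jI_n&B_2\\ C_1&D_{12}\end{pmatrix}\begin{pmatrix}\eta_j\\ \xi_j\end{pmatrix}=0\qquad(j=1,\dots,r).$$ Assume that $\eta_1,\dots,\eta_r$ are linearly independent, that all $\lambda_j$ are real, with $\eta_j\in\mathbb{R}^n$ and $\xi_j\in\mathbb{R}^{m_2}$, and that there are no invariant zeros on the imaginary axis. Put $\hat H=(\eta_1,\dots,\eta_r)\in\mathbb{R}^{n\times r}$, $\hat R=(\xi_1,\dots,\xi_r)\in\mathbb{R}^{m_2\times r}$, let $J\in\mathbb{R}^{n\times(n-r)}$ be such that $T=(\hat H,J)$ is non-singular, and partition $$T^{-1}AT=\begin{pmatrix}\tilde A_{11}&\tilde A_{12}\\ \tilde A_{21}&\tilde A_{22}\end{pmatrix},\quad T^{-1}B_i=\begin{pmatrix}\tilde B_{i1}\\ \tilde B_{i2}\end{pmatrix}\ (i=1,2),\quad C_1T=\begin{pmatrix}\tilde C_{11}&\tilde C_{12}\end{pmatrix},$$ where the first blocks have size $r$ and the second blocks size $n-r$. Let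 $\gamma^*$ be the optimal value of $$\inf_{\gamma,X,Y}\ \gamma\quad\text{s.t.}\quad -\begin{pmatrix}\mathrm{He}(AX+B_2Y)&(C_1X+D_{12}Y)^T&B_1\\ C_1X+D_{12}Y&-\gamma I_{p_1}&D_{11}\\ B_1^T&D_{11}^T&-\gamma I_{m_1}\end{pmatrix}\succeq 0,\ \gamma\in\mathbb{R},\ X\in\mathbb{S}^n_+,\ Y\in\mathbb{R}^{m_2\times n},$$ and let $\tilde\gamma^*$ be the optimal value of $$\inf_{\tilde\gamma,\tilde X,\tilde Y}\ \tilde\gamma\quad\text{s.t.}\quad -\begin{pmatrix}\mathrm{He}(\tilde A_{22}\tilde X+\tilde B_{22}\tilde Y)&(\tilde C_{12}\tilde X+D_{12}\tilde Y)^T&\tilde B_{12}\\ \tilde C_{12}\tilde X+D_{12}\tilde Y&-\tilde\gamma I_{p_1}&D_{11}\\ \tilde B_{12}^T&D_{11}^T&-\tilde\gamma I_{m_1}\end{pmatrix}\succeq 0,\ \tilde\gamma\in\mathbb{R},\ \tilde X\in\mathbb{S}^{n-r}_+,\ \tilde Y\in\mathbb{R}^{m_2\times(n-r)}.$$ Let $\tilde K\in\mathbb{R}^{m_2\times(n-r)}$ be a state feedback gain for the subsystem $$\dot{\tilde x}_2=\tilde A_{22}\tilde x_2+\tilde B_{12}w+\tilde B_{22}u,\qquad z=\tilde C_{12}\tilde x_2+D_{11}w+D_{12}u$$ whose performance index is $\tilde\gamma^*$. Then the state feedback gain $$K=(\hat R,\ \tilde K)\,T^{-1}\in\mathbb{R}^{m_2\times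 n}$$ for the system $\dot x=Ax+B_1w+B_2u$, $z=C_1x+D_{11}w+D_{12}u$ has performance index $\tilde\gamma^*$, and this value equals $\gamma^*$.
   Context: $\mathbb{S}^k_+$ denotes the set of $k\times k$ real symmetric positive semidefinite matrices; $M\succeq0$ means $M$ is symmetric positive semidefinite; $\mathrm{He}(M)=M+M^T$. An invariant zero of $(A,B_2,C_1,D_{12})$ is a $\lambda\in\mathbb{C}$ with $\mathrm{rank}\begin{pmatrix}A-\lambda I_n&B_2\\ C_1&D_{12}\end{pmatrix}<n+m_2$. For a system $\dot x=\mathcal{A}x+\mathcal{B}_1w+\mathcal{B}_2u$, $z=\mathcal{C}x+\mathcal{D}_1w+\mathcal{D}_2u$ and a gain $\mathcal{K}$ (state feedback $u=\mathcal{K}x$), the closed loop transfer function is $G_{cl}(s)=(\mathcal{C}+\mathcal{D}_2\mathcal{K})(sI-\mathcal{A}-\mathcal{B}_2\mathcal{K})^{-1}\mathcal{B}_1+\mathcal{D}_1$. The gain $\mathcal{K}$ has performance index $\gamma$ if $\mathcal{A}+\mathcal{B}_2\mathcal{K}$ is Hurwitz stable (all eigenvalues have negative real part) and $\|G_{cl}\|_\infty=\gamma$, where $\|G\|_\infty=\sup_{\omega\in\mathbb{R}}\sigma_{\max}(G(i\omega))$. *)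

theory Defs
  imports
    "Jordan_Normal_Form.DL_Rank"
    "Jordan_Normal_Form.Schur_Decomposition"
    "Jordan_Normal_Form.Gauss_Jordan_Elimination"
    "HOL-Library.Extended_Real"
begin

text \<open>
  A system \<open>x' = A x + B1 w + B2 u\<close>, \<open>z = C x + D1 w + D2 u\<close> is passed around as its six
  matrices; all dimensions are read off from them.
\<close>

abbreviation cmat :: "real mat \<Rightarrow> complex mat" where
  "cmat \<equiv> map_mat complex_of_real"

definition append_cols :: "'a::zero mat \<Rightarrow> 'a mat \<Rightarrow> 'a mat" (infixr \<open>@\<^sub>c\<close> 65) where
  "A @\<^sub>c B = four_block_mat A B (0\<^sub>m 0 (dim_col A)) (0\<^sub>m 0 (dim_col B))"

text \<open>Only meaningful for non-singular arguments; \<open>mat_inverse\<close> is \<open>None\<close> otherwise.\<close>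

definition mat_inv :: "'a::field mat \<Rightarrow> 'a mat" where
  "mat_inv M = the (mat_inverse M)"

definition psd :: "real mat \<Rightarrow> bool" where
  "psd M \<longleftrightarrow> square_mat M \<and> M\<^sup>T = M \<and>
     (\<forall>v \<in> carrier_vec (dim_row M). 0 \<le> v \<bullet> (M *\<^sub>v v))"

definition He :: "real mat \<Rightarrow> real mat" where
  "He M = M + M\<^sup>T"

definition hurwitz :: "real mat \<Rightarrow> bool" where
  "hurwitz M \<longleftrightarrow> (\<forall>l. eigenvalue (cmat M) l \<longrightarrow> Re l < 0)"

definition system_matrix :: "'a::comm_ring_1 mat \<Rightarrow> 'a mat \<Rightarrow> 'a mat \<Rightarrow> 'a mat \<Rightarrow> 'a \<Rightarrow> 'a mat" where
  "system_matrix A B C D l = four_block_mat (A - l \<cdot>\<^sub>m 1\<^sub>m (dim_row A)) B C D"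

definition invariant_zero :: "real mat \<Rightarrow> real mat \<Rightarrow> real mat \<Rightarrow> real mat \<Rightarrow> complex \<Rightarrow> bool" where
  "invariant_zero A B C D l \<longleftrightarrow>
     vec_space.rank (dim_row A + dim_row C) (system_matrix (cmat A) (cmat B) (cmat C) (cmat D) l)
       < dim_row A + dim_col B"

text \<open>The singular values of \<open>M\<close> are the nonnegative square roots of the eigenvalues of \<open>M\<^sup>* M\<close>.\<close>

definition sigma_max :: "complex mat \<Rightarrow> real" where
  "sigma_max M = Max {s. 0 \<le> s \<and> eigenvalue (mat_adjoint M * M) (complex_of_real (s\<^sup>2))}"

definition hinf_norm :: "(complex \<Rightarrow> complex mat) \<Rightarrow> ereal" where
  "hinf_norm G = (SUP w::real. ereal (sigma_max (G (\<i> * complex_of_real w))))"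

definition closed_loop_tf ::
  "real mat \<Rightarrow> real mat \<Rightarrow> real mat \<Rightarrow> real mat \<Rightarrow> real mat \<Rightarrow> real mat \<Rightarrow> real mat
    \<Rightarrow> complex \<Rightarrow> complex mat" where
  "closed_loop_tf A B1 B2 C D1 D2 K s =
     cmat (C + D2 * K) * mat_inv (s \<cdot>\<^sub>m 1\<^sub>m (dim_row A) - cmat A - cmat (B2 * K)) * cmat B1 + cmat D1"

definition has_performance_index ::
  "real mat \<Rightarrow> real mat \<Rightarrow> real mat \<Rightarrow> real mat \<Rightarrow> real mat \<Rightarrow> real mat \<Rightarrow> real mat
    \<Rightarrow> real \<Rightarrow> bool" where
  "has_performance_index A B1 B2 C D1 D2 K g \<longleftrightarrow>
     hurwitz (A + B2 * K) \<and> hinf_norm (closed_loop_tf A B1 B2 C D1 D2 K) = ereal g"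

definition lmi_matrix ::
  "real mat \<Rightarrow> real mat \<Rightarrow> real mat \<Rightarrow> real mat \<Rightarrow> real mat \<Rightarrow> real mat
    \<Rightarrow> real \<Rightarrow> real mat \<Rightarrow> real mat \<Rightarrow> real mat" where
  "lmi_matrix A B1 B2 C D1 D2 g X Y =
     four_block_mat
       (four_block_mat
          (He (A * X + B2 * Y)) ((C * X + D2 * Y)\<^sup>T)
          (C * X + D2 * Y)      ((- g) \<cdot>\<^sub>m 1\<^sub>m (dim_row C)))
       (B1 @\<^sub>r D1)
       (B1\<^sup>T @\<^sub>c D1\<^sup>T)
       ((- g) \<cdot>\<^sub>m 1\<^sub>m (dim_col B1))"

text \<open>The infimum is taken in the extended reals, so an infeasible problem has value \<open>\<infinity>\<close>.\<close>

definition lmi_optimal_value ::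
  "real mat \<Rightarrow> real mat \<Rightarrow> real mat \<Rightarrow> real mat \<Rightarrow> real mat \<Rightarrow> real mat \<Rightarrow> ereal" where
  "lmi_optimal_value A B1 B2 C D1 D2 =
     Inf {ereal g | g X Y.
            X \<in> carrier_mat (dim_row A) (dim_row A) \<and> psd X \<and>
            Y \<in> carrier_mat (dim_col B2) (dim_row A) \<and>
            psd (- lmi_matrix A B1 B2 C D1 D2 g X Y)}"

end

(* The null vectors supply R with A H + B2 R = H Lambda, C1 H + D12 R = 0 and Lambda diagonal with
   negative entries. Put T = (H, J) and T^-1 = (P; E). Under the gain R P + Kt E the subspace spanned
   by H is invariant, stable and invisible at the output, so E maps the closed loop onto that of the
   subsystem, with the same transfer function.

   For the optimal values, compressing a solution by X |-> E X E^T, Y |-> (Y - R P X) E^T shows that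
   every level feasible for the full LMI is feasible for the reduced one. Conversely, let (X, Y) solve
   the reduced LMI at level g. Since a stabilizing gain exists, adding a small multiple of a Lyapunov
   matrix of the stabilized subsystem makes the state block strictly negative, at the cost of an
   arbitrarily small increase of g. Then t H H^T + J X J^T and t R H^T + Y J^T solve the full LMI for
   large t, because 2 t Lambda dominates the coupling terms. *)

theory Submission
  imports Defs "HOL-Analysis.Convex"
begin

section \<open>Block matrices and the quadratic form of the LMI\<close>

text \<open>The obstacle is that the reduced LMI is feasible only in the semidefinite sense. In the
  coordinates given by \<open>T\<close>, the extended solution has a coupling block
  \<open>G = A12 * X2 + B21 * Y2\<close> between the two groups of states. Completing squares
  absorbs it if both diagonal blocks are strictly negative. The first is a multiple of Lambda,
  negative because zeros on the imaginary axis are excluded; the second need not be, hence the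
  detour through a Lyapunov matrix. Taking \<open>t\<close> large afterwards is harmless:
  \<open>G\<close> does not depend on \<open>t\<close>, and \<open>C * H + D2 * R = 0\<close>
  removes \<open>t\<close> from the output row, so the level is not affected.

  The gain and the optimal values are treated separately. By hypothesis \<open>gammat\<close> is
  both the norm reached by \<open>Kt\<close> and the reduced optimal value, so it suffices to carry
  each of these two quantities over to the full system. Both transfers rest on the same fact:
  \<open>E\<close> is the quotient map by the range of \<open>H\<close>, and after the preliminary
  feedback \<open>R * P\<close> the state and output matrices induce \<open>A22\<close> and
  \<open>C2\<close> on the quotient.\<close>

lemma append_cols_carrier [simp]:
  assumes "A \<in> carrier_mat n m" "B \<in> carrier_mat n k"
  shows "A @\<^sub>c B \<in> carrier_mat n (m + k)"
  by (rule carrier_matI) (use assms in \<open>simp_all add: append_cols_def\<close>)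

lemma append_cols_mult_vec:
  assumes "A \<in> carrier_mat n m" "B \<in> carrier_mat n k" "x \<in> carrier_vec m" "y \<in> carrier_vec k"
  shows "(A @\<^sub>c B) *\<^sub>v (x @\<^sub>v y) = A *\<^sub>v x + B *\<^sub>v y"
proof -
  have d: "dim_col A = m" "dim_col B = k" using assms by auto
  have "(A @\<^sub>c B) *\<^sub>v (x @\<^sub>v y) =
    (A *\<^sub>v x + B *\<^sub>v y) @\<^sub>v (0\<^sub>m 0 m *\<^sub>v x + 0\<^sub>m 0 k *\<^sub>v y)"
    unfolding append_cols_def d by (rule four_block_mat_mult_vec[OF assms(1,2) _ _ assms(3,4)]) auto
  also have "\<dots> = A *\<^sub>v x + B *\<^sub>v y" by (rule eq_vecI) auto
  finally show ?thesis .
qed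

lemma col_append_cols:
  assumes "A \<in> carrier_mat n m" "B \<in> carrier_mat n k" "j < m + k"
  shows "col (A @\<^sub>c B) j = (if j < m then col A j else col B (j - m))"
  by (rule eq_vecI) (use assms in \<open>auto simp: append_cols_def\<close>)

lemma row_append_rows:
  assumes "A \<in> carrier_mat m n" "B \<in> carrier_mat k n" "i < m + k"
  shows "row (A @\<^sub>r B) i = (if i < m then row A i else row B (i - m))"
  by (rule eq_vecI) (use assms in \<open>auto simp: append_rows_def\<close>)

lemma mult_append_cols:
  assumes M: "M \<in> carrier_mat l n" and A: "A \<in> carrier_mat n m" and B: "B \<in> carrier_mat n k"
  shows "M * (A @\<^sub>c B) = (M * A) @\<^sub>c (M * B)"
proof (rule eq_matI)
  fix i j assume "i < dim_row ((M * A) @\<^sub>c (M * B))" "j < dim_col ((M * A) @\<^sub>c (M * B))"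
  then have ij: "i < l" "j < m + k" using M A B by (auto simp: append_cols_def)
  then have "(M * (A @\<^sub>c B)) $$ (i, j) = row M i \<bullet> col (A @\<^sub>c B) j"
    using M A B by (simp add: append_cols_def)
  then show "(M * (A @\<^sub>c B)) $$ (i, j) = ((M * A) @\<^sub>c (M * B)) $$ (i, j)"
    using M A B ij by (simp add: col_append_cols[OF A B]) (simp add: append_cols_def)
qed (use assms in \<open>simp_all add: append_cols_def\<close>)

lemma append_cols_mult_four_block:
  assumes H: "H \<in> carrier_mat l n1" "J \<in> carrier_mat l n2"
    and M: "M1 \<in> carrier_mat n1 c1" "M2 \<in> carrier_mat n1 c2"
      "M3 \<in> carrier_mat n2 c1" "M4 \<in> carrier_mat n2 c2"
  shows "(H @\<^sub>c J) * four_block_mat M1 M2 M3 M4 =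
    (H * M1 + J * M3) @\<^sub>c (H * M2 + J * M4)"
proof -
  have "four_block_mat H J (0\<^sub>m 0 n1) (0\<^sub>m 0 n2) * four_block_mat M1 M2 M3 M4 =
      four_block_mat (H * M1 + J * M3) (H * M2 + J * M4)
        (0\<^sub>m 0 n1 * M1 + 0\<^sub>m 0 n2 * M3) (0\<^sub>m 0 n1 * M2 + 0\<^sub>m 0 n2 * M4)"
    by (rule mult_four_block_mat[OF H _ _ M]) auto
  also have "0\<^sub>m 0 n1 * M1 + 0\<^sub>m 0 n2 * M3 = 0\<^sub>m 0 c1" by (rule eq_matI) (use M in simp_all)
  also have "0\<^sub>m 0 n1 * M2 + 0\<^sub>m 0 n2 * M4 = 0\<^sub>m 0 c2" by (rule eq_matI) (use M in simp_all)
  finally show ?thesis using H M by (simp add: append_cols_def)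
qed

lemma append_cols_mult_append_rows:
  assumes "H \<in> carrier_mat l n1" "J \<in> carrier_mat l n2"
    and "P \<in> carrier_mat n1 c" "E \<in> carrier_mat n2 c"
  shows "(H @\<^sub>c J) * (P @\<^sub>r E) = H * P + J * E"
proof -
  have d: "dim_row P = n1" "dim_row E = n2" using assms by auto
  have "(H @\<^sub>c J) * (P @\<^sub>r E) = (H * P + J * E) @\<^sub>c (H * 0\<^sub>m n1 0 + J * 0\<^sub>m n2 0)"
    unfolding append_rows_def d by (rule append_cols_mult_four_block[OF assms(1,2,3) _ assms(4)]) auto
  also have "\<dots> = H * P + J * E"
    by (rule eq_matI) (use assms in \<open>simp_all add: append_cols_def\<close>)
  finally show ?thesis .
qed

lemma append_rows_mult_append_cols:
  assumes P: "P \<in> carrier_mat n1 l" and E: "E \<in> carrier_mat n2 l"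
    and H: "H \<in> carrier_mat l c1" and J: "J \<in> carrier_mat l c2"
  shows "(P @\<^sub>r E) * (H @\<^sub>c J) = four_block_mat (P * H) (P * J) (E * H) (E * J)"
proof (rule eq_matI)
  let ?F = "four_block_mat (P * H) (P * J) (E * H) (E * J)"
  fix i j assume "i < dim_row ?F" "j < dim_col ?F"
  then have ij: "i < n1 + n2" "j < c1 + c2" using assms by auto
  then have "((P @\<^sub>r E) * (H @\<^sub>c J)) $$ (i, j) = row (P @\<^sub>r E) i \<bullet> col (H @\<^sub>c J) j"
    using assms by (simp add: append_cols_def append_rows_def)
  then show "((P @\<^sub>r E) * (H @\<^sub>c J)) $$ (i, j) = ?F $$ (i, j)"
    using assms ij by (simp add: col_append_cols[OF H J] row_append_rows[OF P E])
qed (use assms in \<open>simp_all add: append_cols_def append_rows_def\<close>)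

lemma append_cols_inject:
  assumes "A \<in> carrier_mat n m" "B \<in> carrier_mat n k" "A' \<in> carrier_mat n m" "B' \<in> carrier_mat n k"
    and eq: "A @\<^sub>c B = A' @\<^sub>c B'"
  shows "A = A'" "B = B'"
proof -
  show "A = A'"
  proof (rule eq_matI)
    fix i j assume "i < dim_row A'" "j < dim_col A'"
    then show "A $$ (i, j) = A' $$ (i, j)"
      using assms(1-4) arg_cong[OF eq, of "\<lambda>M. M $$ (i, j)"] by (simp add: append_cols_def)
  qed (use assms in auto)
  show "B = B'"
  proof (rule eq_matI)
    fix i j assume "i < dim_row B'" "j < dim_col B'"
    then show "B $$ (i, j) = B' $$ (i, j)"
      using assms(1-4) arg_cong[OF eq, of "\<lambda>M. M $$ (i, j + m)"] by (simp add: append_cols_def)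
  qed (use assms in auto)
qed

lemma four_block_mat_inject:
  assumes "A \<in> carrier_mat n m" "B \<in> carrier_mat n m'" "C \<in> carrier_mat n' m" "D \<in> carrier_mat n' m'"
    and "A' \<in> carrier_mat n m" "B' \<in> carrier_mat n m'" "C' \<in> carrier_mat n' m" "D' \<in> carrier_mat n' m'"
    and eq: "four_block_mat A B C D = four_block_mat A' B' C' D'"
  shows "A = A'" "B = B'" "C = C'" "D = D'"
proof -
  note c = assms(1-8)
  have e: "four_block_mat A B C D $$ (i, j) = four_block_mat A' B' C' D' $$ (i, j)" for i j
    using eq by simp
  show "A = A'"
  proof (rule eq_matI)
    fix i j assume "i < dim_row A'" "j < dim_col A'"
    then show "A $$ (i, j) = A' $$ (i, j)" using c e[of i j] by simp
  qed (use c in auto)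
  show "B = B'"
  proof (rule eq_matI)
    fix i j assume "i < dim_row B'" "j < dim_col B'"
    then show "B $$ (i, j) = B' $$ (i, j)" using c e[of i "j + m"] by simp
  qed (use c in auto)
  show "C = C'"
  proof (rule eq_matI)
    fix i j assume "i < dim_row C'" "j < dim_col C'"
    then show "C $$ (i, j) = C' $$ (i, j)" using c e[of "i + n" j] by simp
  qed (use c in auto)
  show "D = D'"
  proof (rule eq_matI)
    fix i j assume "i < dim_row D'" "j < dim_col D'"
    then show "D $$ (i, j) = D' $$ (i, j)" using c e[of "i + n" "j + m"] by simp
  qed (use c in auto)
qed

lemma scalar_prod_transpose:
  fixes M :: "'a::comm_semiring_0 mat"
  assumes "M \<in> carrier_mat n m" "x \<in> carrier_vec m" "z \<in> carrier_vec n"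
  shows "x \<bullet> (M\<^sup>T *\<^sub>v z) = z \<bullet> (M *\<^sub>v x)"
  using transpose_vec_mult_scalar[OF assms] assms
  by (metis comm_scalar_prod mult_mat_vec_carrier transpose_carrier_mat)

lemma smult_one_mult_vec:
  fixes z :: "'a::comm_ring_1 vec"
  assumes "z \<in> carrier_vec n"
  shows "(c \<cdot>\<^sub>m 1\<^sub>m n) *\<^sub>v z = c \<cdot>\<^sub>v z"
  by (rule eq_vecI) (use assms in auto)

text \<open>Symmetric off-diagonal blocks pair up, which gives the factors 2. With feasibility
  stated as a scalar inequality, later congruences become substitutions of vectors.\<close>

lemma psd_lmi_matrix_iff:
  assumes A: "A \<in> carrier_mat n n" and B1: "B1 \<in> carrier_mat n m" and B2: "B2 \<in> carrier_mat n q"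
    and C: "C \<in> carrier_mat p n" and D1: "D1 \<in> carrier_mat p m" and D2: "D2 \<in> carrier_mat p q"
    and X: "X \<in> carrier_mat n n" and Y: "Y \<in> carrier_mat q n"
  shows "psd (- lmi_matrix A B1 B2 C D1 D2 g X Y) \<longleftrightarrow>
    (\<forall>x\<in>carrier_vec n. \<forall>z\<in>carrier_vec p. \<forall>w\<in>carrier_vec m.
      2 * (x \<bullet> ((A * X + B2 * Y) *\<^sub>v x)) + 2 * (z \<bullet> ((C * X + D2 * Y) *\<^sub>v x))
        + 2 * (x \<bullet> (B1 *\<^sub>v w)) + 2 * (z \<bullet> (D1 *\<^sub>v w)) \<le> g * (z \<bullet> z + w \<bullet> w))"
proof -
  define L where "L = A * X + B2 * Y"
  define M where "M = C * X + D2 * Y"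
  define F where "F = four_block_mat (He L) (M\<^sup>T) M ((- g) \<cdot>\<^sub>m 1\<^sub>m p)"
  define W where "W = lmi_matrix A B1 B2 C D1 D2 g X Y"
  have L: "L \<in> carrier_mat n n" and M: "M \<in> carrier_mat p n"
    using assms by (auto simp: L_def M_def)
  have HL: "He L \<in> carrier_mat n n" using L by (auto simp: He_def)
  have MT: "M\<^sup>T \<in> carrier_mat n p" and B1T: "B1\<^sup>T \<in> carrier_mat m n" and D1T: "D1\<^sup>T \<in> carrier_mat m p"
    using M B1 D1 by auto
  have F: "F \<in> carrier_mat (n + p) (n + p)" using HL M by (auto simp: F_def)
  have BD: "B1 @\<^sub>r D1 \<in> carrier_mat (n + p) m" using B1 D1 by auto
  have BDT: "B1\<^sup>T @\<^sub>c D1\<^sup>T \<in> carrier_mat m (n + p)" using B1 D1 by simp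
  have gm: "(- g) \<cdot>\<^sub>m 1\<^sub>m m \<in> carrier_mat m m" and gp: "(- g) \<cdot>\<^sub>m 1\<^sub>m p \<in> carrier_mat p p" by auto
  have W_eq: "W = four_block_mat F (B1 @\<^sub>r D1) (B1\<^sup>T @\<^sub>c D1\<^sup>T) ((- g) \<cdot>\<^sub>m 1\<^sub>m m)"
    using B1 C by (simp add: W_def lmi_matrix_def F_def L_def M_def)
  have W: "W \<in> carrier_mat (n + p + m) (n + p + m)" using F by (auto simp: W_eq)
  have sym: "(- W)\<^sup>T = - W"
  proof -
    have "F\<^sup>T = F"
      using L M unfolding F_def He_def by (intro eq_matI) (auto simp: comm_add_mat add.commute)
    then have s: "F $$ (j, i) = F $$ (i, j)" if "i < n + p" "j < n + p" for i j
      using F that by (metis carrier_matD index_transpose_mat(1))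
    have "W\<^sup>T = W"
      by (rule eq_matI)
         (use F B1 D1 s in \<open>auto simp: W_eq append_rows_def append_cols_def\<close>)
    then show ?thesis by (simp add: transpose_uminus)
  qed
  have form: "(x @\<^sub>v z @\<^sub>v w) \<bullet> (- W *\<^sub>v (x @\<^sub>v z @\<^sub>v w)) = g * (z \<bullet> z + w \<bullet> w) -
      (2 * (x \<bullet> (L *\<^sub>v x)) + 2 * (z \<bullet> (M *\<^sub>v x)) + 2 * (x \<bullet> (B1 *\<^sub>v w)) + 2 * (z \<bullet> (D1 *\<^sub>v w)))"
    if x: "x \<in> carrier_vec n" and z: "z \<in> carrier_vec p" and w: "w \<in> carrier_vec m" for x z w
  proof -
    have xz: "x @\<^sub>v z \<in> carrier_vec (n + p)" using x z by simp
    \<comment> \<open>\<open>lmi_matrix\<close> groups state and output in its inner block, whereas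
      \<open>all_vec_append\<close> below splits a vector from the left.\<close>
    have xzw: "x @\<^sub>v z @\<^sub>v w = (x @\<^sub>v z) @\<^sub>v w" by (rule eq_vecI) (use x z w in auto)
    have "W *\<^sub>v ((x @\<^sub>v z) @\<^sub>v w) =
        (F *\<^sub>v (x @\<^sub>v z) + (B1 @\<^sub>r D1) *\<^sub>v w) @\<^sub>v
        ((B1\<^sup>T @\<^sub>c D1\<^sup>T) *\<^sub>v (x @\<^sub>v z) + ((- g) \<cdot>\<^sub>m 1\<^sub>m m) *\<^sub>v w)"
      unfolding W_eq by (rule four_block_mat_mult_vec[OF F BD BDT gm xz w])
    also have "F *\<^sub>v (x @\<^sub>v z) = (He L *\<^sub>v x + M\<^sup>T *\<^sub>v z) @\<^sub>v (M *\<^sub>v x + ((- g) \<cdot>\<^sub>m 1\<^sub>m p) *\<^sub>v z)"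
      unfolding F_def by (rule four_block_mat_mult_vec[OF HL MT M gp x z])
    also have "(B1 @\<^sub>r D1) *\<^sub>v w = (B1 *\<^sub>v w) @\<^sub>v (D1 *\<^sub>v w)"
      by (rule mat_mult_append[OF B1 D1 w])
    also have "(B1\<^sup>T @\<^sub>c D1\<^sup>T) *\<^sub>v (x @\<^sub>v z) = B1\<^sup>T *\<^sub>v x + D1\<^sup>T *\<^sub>v z"
      by (rule append_cols_mult_vec[OF B1T D1T x z])
    finally have Wv: "W *\<^sub>v ((x @\<^sub>v z) @\<^sub>v w) =
        (((He L *\<^sub>v x + M\<^sup>T *\<^sub>v z) @\<^sub>v (M *\<^sub>v x + ((- g) \<cdot>\<^sub>m 1\<^sub>m p) *\<^sub>v z)) + ((B1 *\<^sub>v w) @\<^sub>v (D1 *\<^sub>v w))) @\<^sub>v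
        (B1\<^sup>T *\<^sub>v x + D1\<^sup>T *\<^sub>v z + ((- g) \<cdot>\<^sub>m 1\<^sub>m m) *\<^sub>v w)" .
    also have "((He L *\<^sub>v x + M\<^sup>T *\<^sub>v z) @\<^sub>v (M *\<^sub>v x + ((- g) \<cdot>\<^sub>m 1\<^sub>m p) *\<^sub>v z)) + ((B1 *\<^sub>v w) @\<^sub>v (D1 *\<^sub>v w)) =
        (He L *\<^sub>v x + M\<^sup>T *\<^sub>v z + B1 *\<^sub>v w) @\<^sub>v (M *\<^sub>v x + ((- g) \<cdot>\<^sub>m 1\<^sub>m p) *\<^sub>v z + D1 *\<^sub>v w)"
      by (rule append_vec_add[of _ n _ _ p]) (use HL M B1 D1 x z w in \<open>auto simp: smult_one_mult_vec\<close>)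
    finally have "((x @\<^sub>v z) @\<^sub>v w) \<bullet> (W *\<^sub>v ((x @\<^sub>v z) @\<^sub>v w)) =
        (x @\<^sub>v z) \<bullet> ((He L *\<^sub>v x + M\<^sup>T *\<^sub>v z + B1 *\<^sub>v w) @\<^sub>v (M *\<^sub>v x + ((- g) \<cdot>\<^sub>m 1\<^sub>m p) *\<^sub>v z + D1 *\<^sub>v w)) +
        w \<bullet> (B1\<^sup>T *\<^sub>v x + D1\<^sup>T *\<^sub>v z + ((- g) \<cdot>\<^sub>m 1\<^sub>m m) *\<^sub>v w)"
      by (simp only:, intro scalar_prod_append[of _ "n + p" _ m]) (use HL M B1 D1 x z w in \<open>auto simp: smult_one_mult_vec\<close>)
    also have "(x @\<^sub>v z) \<bullet> ((He L *\<^sub>v x + M\<^sup>T *\<^sub>v z + B1 *\<^sub>v w) @\<^sub>v (M *\<^sub>v x + ((- g) \<cdot>\<^sub>m 1\<^sub>m p) *\<^sub>v z + D1 *\<^sub>v w)) =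
        x \<bullet> (He L *\<^sub>v x + M\<^sup>T *\<^sub>v z + B1 *\<^sub>v w) + z \<bullet> (M *\<^sub>v x + ((- g) \<cdot>\<^sub>m 1\<^sub>m p) *\<^sub>v z + D1 *\<^sub>v w)"
      by (intro scalar_prod_append[of _ n _ p]) (use HL M B1 D1 x z w in \<open>auto simp: smult_one_mult_vec\<close>)
    also have "x \<bullet> (He L *\<^sub>v x + M\<^sup>T *\<^sub>v z + B1 *\<^sub>v w) = x \<bullet> (He L *\<^sub>v x) + x \<bullet> (M\<^sup>T *\<^sub>v z) + x \<bullet> (B1 *\<^sub>v w)"
      using HL M B1 x z w by (simp add: scalar_prod_add_distrib[of _ n])
    also have "x \<bullet> (M\<^sup>T *\<^sub>v z) = z \<bullet> (M *\<^sub>v x)" by (rule scalar_prod_transpose[OF M x z])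
    also have "x \<bullet> (He L *\<^sub>v x) = 2 * (x \<bullet> (L *\<^sub>v x))"
      using L x unfolding He_def
      by (simp add: add_mult_distrib_mat_vec[of _ n n] scalar_prod_add_distrib[of _ n]
          scalar_prod_transpose[of _ n n])
    also have "z \<bullet> (M *\<^sub>v x + ((- g) \<cdot>\<^sub>m 1\<^sub>m p) *\<^sub>v z + D1 *\<^sub>v w) =
        z \<bullet> (M *\<^sub>v x) - g * (z \<bullet> z) + z \<bullet> (D1 *\<^sub>v w)"
      using M D1 x z w
      by (simp add: scalar_prod_add_distrib[of _ p] smult_one_mult_vec[of _ p])
    also have "w \<bullet> (B1\<^sup>T *\<^sub>v x + D1\<^sup>T *\<^sub>v z + ((- g) \<cdot>\<^sub>m 1\<^sub>m m) *\<^sub>v w) =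
        x \<bullet> (B1 *\<^sub>v w) + z \<bullet> (D1 *\<^sub>v w) - g * (w \<bullet> w)"
      using B1 D1 x z w
      by (simp add: scalar_prod_add_distrib[of _ m] smult_one_mult_vec[of _ m]
          scalar_prod_transpose[of B1 n m] scalar_prod_transpose[of D1 p m])
    finally have "((x @\<^sub>v z) @\<^sub>v w) \<bullet> (W *\<^sub>v ((x @\<^sub>v z) @\<^sub>v w)) =
        2 * (x \<bullet> (L *\<^sub>v x)) + z \<bullet> (M *\<^sub>v x) + x \<bullet> (B1 *\<^sub>v w) +
        (z \<bullet> (M *\<^sub>v x) - g * (z \<bullet> z) + z \<bullet> (D1 *\<^sub>v w)) +
        (x \<bullet> (B1 *\<^sub>v w) + z \<bullet> (D1 *\<^sub>v w) - g * (w \<bullet> w))" .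
    moreover have "v \<bullet> (- W *\<^sub>v v) = - (v \<bullet> (W *\<^sub>v v))" if "v \<in> carrier_vec (n + p + m)" for v
      using W that by simp
    ultimately show ?thesis
      using x z w unfolding xzw by (simp add: ring_distribs)
  qed
  have "psd (- W) \<longleftrightarrow> (\<forall>v\<in>carrier_vec (n + (p + m)). 0 \<le> v \<bullet> (- W *\<^sub>v v))"
    using W sym by (simp add: psd_def add.assoc)
  also have "\<dots> \<longleftrightarrow> (\<forall>x\<in>carrier_vec n. \<forall>z\<in>carrier_vec p. \<forall>w\<in>carrier_vec m.
      0 \<le> (x @\<^sub>v z @\<^sub>v w) \<bullet> (- W *\<^sub>v (x @\<^sub>v z @\<^sub>v w)))"
    by (simp only: all_vec_append)
  also have "\<dots> \<longleftrightarrow> (\<forall>x\<in>carrier_vec n. \<forall>z\<in>carrier_vec p. \<forall>w\<in>carrier_vec m.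
      2 * (x \<bullet> (L *\<^sub>v x)) + 2 * (z \<bullet> (M *\<^sub>v x)) + 2 * (x \<bullet> (B1 *\<^sub>v w)) + 2 * (z \<bullet> (D1 *\<^sub>v w))
        \<le> g * (z \<bullet> z + w \<bullet> w))"
    by (simp add: form)
  finally show ?thesis unfolding W_def L_def M_def .
qed

section \<open>Lyapunov matrices of Hurwitz matrices\<close>

lemma young_product:
  fixes p q e :: real
  assumes "0 < e"
  shows "2 * (p * q) \<le> p\<^sup>2 / e + e * q\<^sup>2"
proof -
  have "0 \<le> (p - e * q)\<^sup>2 / e" using assms by simp
  also have "\<dots> = p\<^sup>2 / e + e * q\<^sup>2 - 2 * (p * q)"
    using assms by (simp add: power2_eq_square field_simps)
  finally show ?thesis by simp
qed

lemma sum_mult_le_sum_mult_sum: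
  fixes s t :: "'a \<Rightarrow> real"
  assumes "finite I" "\<And>i. i \<in> I \<Longrightarrow> 0 \<le> s i" "\<And>i. i \<in> I \<Longrightarrow> 0 \<le> t i"
  shows "(\<Sum>i\<in>I. s i * t i) \<le> (\<Sum>i\<in>I. s i) * (\<Sum>i\<in>I. t i)"
proof -
  have "(\<Sum>i\<in>I. s i * t i) \<le> (\<Sum>i\<in>I. (\<Sum>k\<in>I. s k) * t i)"
    by (intro sum_mono mult_right_mono member_le_sum assms) auto
  then show ?thesis by (simp add: sum_distrib_left)
qed

lemma scalar_prod_self:
  fixes v :: "real vec"
  assumes "v \<in> carrier_vec n"
  shows "v \<bullet> v = (\<Sum>i<n. (v $ i)\<^sup>2)"
  using assms by (simp add: scalar_prod_def power2_eq_square atLeast0LessThan)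

lemma scalar_prod_self_nonneg:
  fixes v :: "real vec"
  shows "0 \<le> v \<bullet> v"
  unfolding scalar_prod_def by (intro sum_nonneg) simp

text \<open>Absorbs cross terms: any share \<open>e\<close> of the second square, however small, can
  be bought with a large multiple \<open>c\<close> of the first. Young's inequality is applied entry
  by entry.\<close>

lemma mat_form_young:
  fixes F :: "real mat"
  assumes F: "F \<in> carrier_mat n m" and e: "0 < e"
  obtains c where "0 \<le> c"
    "\<And>a b. a \<in> carrier_vec n \<Longrightarrow> b \<in> carrier_vec m \<Longrightarrow>
      2 * (a \<bullet> (F *\<^sub>v b)) \<le> c * (a \<bullet> a) + e * (b \<bullet> b)"
proof -
  \<comment> \<open>Each \<open>(b $ j)\<^sup>2\<close> is charged once in every one of the
    \<open>n\<close> rows, so one charge may be at most \<open>e / n\<close>; the \<open>+ 1\<close>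
    covers \<open>n = 0\<close>.\<close>
  define h where "h = e / (real n + 1)"
  have h: "0 < h" using e by (simp add: h_def)
  define s where "s i = (\<Sum>j<m. (F $$ (i, j))\<^sup>2) / h" for i
  have s: "0 \<le> s i" for i using h by (simp add: s_def sum_nonneg)
  have "2 * (a \<bullet> (F *\<^sub>v b)) \<le> (\<Sum>i<n. s i) * (a \<bullet> a) + e * (b \<bullet> b)"
    if a: "a \<in> carrier_vec n" and b: "b \<in> carrier_vec m" for a b
  proof -
    have "2 * (a \<bullet> (F *\<^sub>v b)) = (\<Sum>i<n. \<Sum>j<m. 2 * ((F $$ (i, j) * a $ i) * b $ j))"
      using F a b
      by (auto simp: scalar_prod_def atLeast0LessThan sum_distrib_left mult_ac intro!: sum.cong)
    also have "\<dots> \<le> (\<Sum>i<n. \<Sum>j<m. (F $$ (i, j) * a $ i)\<^sup>2 / h + h * (b $ j)\<^sup>2)"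
      by (intro sum_mono young_product h)
    also have "\<dots> = (\<Sum>i<n. s i * (a $ i)\<^sup>2) + real n * h * (b \<bullet> b)"
      using b by (simp add: sum.distrib s_def scalar_prod_self power_mult_distrib sum_distrib_left
          sum_distrib_right sum_divide_distrib mult_ac)
    also have "\<dots> \<le> (\<Sum>i<n. s i) * (\<Sum>i<n. (a $ i)\<^sup>2) + e * (b \<bullet> b)"
    proof (intro add_mono sum_mult_le_sum_mult_sum mult_right_mono)
      show "real n * h \<le> e" using e by (simp add: h_def field_simps)
    qed (auto simp: s scalar_prod_self_nonneg)
    finally show ?thesis using a by (simp add: scalar_prod_self)
  qed
  then show thesis using that s by (meson sum_nonneg)
qed

text \<open>The weights are chosen from the first to the last index: each new one is so small that the
  entries above the corresponding diagonal element are absorbed.\<close>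

lemma triangular_diagonal_lyapunov:
  fixes B :: "nat \<Rightarrow> nat \<Rightarrow> complex"
  assumes "\<And>i. i < n \<Longrightarrow> Re (B i i) < 0"
    and "\<And>i j. j < i \<Longrightarrow> i < n \<Longrightarrow> B i j = 0"
  shows "\<exists>d \<mu>. (\<forall>i<n. 0 < d i) \<and> 0 < \<mu> \<and>
    (\<forall>y. Re (\<Sum>i<n. \<Sum>j<n. cnj (y i) * (B i j * (of_real (d j) * y j)))
      \<le> - \<mu> * (\<Sum>i<n. (cmod (y i))\<^sup>2))"
  using assms
proof (induction n)
  case 0
  show ?case by (intro exI[of _ "\<lambda>_. 1"] exI[of _ 1]) simp
next
  case (Suc n)
  have "\<And>i. i < n \<Longrightarrow> Re (B i i) < 0" "\<And>i j. j < i \<Longrightarrow> i < n \<Longrightarrow> B i j = 0"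
    using Suc.prems by simp_all
  from Suc.IH[OF this] obtain d \<mu> where d: "\<forall>i<n. 0 < d i" and \<mu>: "0 < \<mu>"
    and neg: "\<And>y. Re (\<Sum>i<n. \<Sum>j<n. cnj (y i) * (B i j * (of_real (d j) * y j)))
      \<le> - \<mu> * (\<Sum>i<n. (cmod (y i))\<^sup>2)"
    by blast
  define \<beta> where "\<beta> = - Re (B n n)"
  have \<beta>: "0 < \<beta>" using Suc.prems(1)[of n] by (simp add: \<beta>_def)
  \<comment> \<open>The new square \<open>q\<close> is charged \<open>h\<close> once for each of the
    \<open>n\<close> entries above the diagonal, in total at most \<beta>.\<close>
  define h where "h = \<beta> / (real n + 1)"
  have h: "0 < h" using \<beta> by (simp add: h_def)
  define c where "c = (\<Sum>i<n. (cmod (B i n))\<^sup>2 / h)"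
  have c: "0 \<le> c" using h by (simp add: c_def sum_nonneg)
  \<comment> \<open>By triangularity row \<open>n\<close> contributes only its diagonal entry, and
    column \<open>n\<close> carries the single weight \<open>e\<close>. Since
    \<open>e * c \<le> \<mu>\<close>, its cross terms use up at most half of the old decay
    \<open>\<mu> * S\<close> and half of the new decay \<open>e * \<beta> * q\<close>;
    \<open>\<mu>'\<close> is the smaller of the two remaining rates.\<close>
  define e where "e = \<mu> / (c + 1)"
  have e: "0 < e" and ec: "e * c \<le> \<mu>" using \<mu> c by (simp_all add: e_def field_simps)
  define d' where "d' = d(n := e)"
  define \<mu>' where "\<mu>' = min (\<mu> / 2) (e * \<beta> / 2)"
  have \<mu>': "0 < \<mu>'" "\<mu>' \<le> \<mu> / 2" "\<mu>' \<le> e * \<beta> / 2" using \<mu> e \<beta> by (auto simp: \<mu>'_def)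
  have "Re (\<Sum>i<Suc n. \<Sum>j<Suc n. cnj (y i) * (B i j * (of_real (d' j) * y j)))
      \<le> - \<mu>' * (\<Sum>i<Suc n. (cmod (y i))\<^sup>2)" for y
  proof -
    define S where "S = (\<Sum>i<n. (cmod (y i))\<^sup>2)"
    define q where "q = (cmod (y n))\<^sup>2"
    have S: "0 \<le> S" and q: "0 \<le> q" by (simp_all add: S_def q_def sum_nonneg)
    have old: "Re (\<Sum>i<n. \<Sum>j<n. cnj (y i) * (B i j * (of_real (d' j) * y j))) \<le> - \<mu> * S"
      using neg[of y] by (simp add: d'_def S_def)
    have "Re (\<Sum>i<n. cnj (y i) * (B i n * y n)) \<le> (\<Sum>i<n. (cmod (B i n) * cmod (y i)) * cmod (y n))"
      unfolding Re_sum
      by (intro sum_mono order_trans[OF complex_Re_le_cmod]) (simp add: norm_mult mult_ac)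
    also have "\<dots> \<le> (\<Sum>i<n. ((cmod (B i n) * cmod (y i))\<^sup>2 / h + h * q) / 2)"
    proof (rule sum_mono)
      fix i
      show "cmod (B i n) * cmod (y i) * cmod (y n) \<le> ((cmod (B i n) * cmod (y i))\<^sup>2 / h + h * q) / 2"
        using young_product[OF h, of "cmod (B i n) * cmod (y i)" "cmod (y n)"] by (simp add: q_def)
    qed
    also have "\<dots> = ((\<Sum>i<n. (cmod (B i n))\<^sup>2 / h * (cmod (y i))\<^sup>2) + real n * h * q) / 2"
      by (simp add: sum.distrib sum_divide_distrib[symmetric] power_mult_distrib)
    also have "\<dots> \<le> (c * S + \<beta> * q) / 2"
    proof -
      have "(\<Sum>i<n. (cmod (B i n))\<^sup>2 / h * (cmod (y i))\<^sup>2) \<le> c * S"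
        unfolding c_def S_def using h by (intro sum_mult_le_sum_mult_sum) auto
      moreover have "real n * h * q \<le> \<beta> * q"
        using \<beta> by (intro mult_right_mono q) (simp add: h_def field_simps)
      ultimately show ?thesis by simp
    qed
    finally have "e * Re (\<Sum>i<n. cnj (y i) * (B i n * y n)) \<le> e * ((c * S + \<beta> * q) / 2)"
      using e by simp
    also have "\<dots> \<le> \<mu> * S / 2 + e * \<beta> * q / 2"
      using mult_right_mono[OF ec S] by (simp add: field_simps)
    finally have col: "e * Re (\<Sum>i<n. cnj (y i) * (B i n * y n)) \<le> \<mu> * S / 2 + e * \<beta> * q / 2" .
    have diag: "Re (cnj (y n) * (B n n * y n)) = - \<beta> * q"
    proof -
      have "of_real q = y n * cnj (y n)" by (simp only: q_def complex_norm_square)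
      then have "cnj (y n) * (B n n * y n) = B n n * of_real q" by (simp only: mult_ac)
      then show ?thesis by (simp only:) (simp add: \<beta>_def)
    qed
    have "(\<Sum>i<Suc n. \<Sum>j<Suc n. cnj (y i) * (B i j * (of_real (d' j) * y j))) =
        (\<Sum>i<n. \<Sum>j<n. cnj (y i) * (B i j * (of_real (d' j) * y j))) +
        of_real e * (\<Sum>i<n. cnj (y i) * (B i n * y n)) + of_real e * (cnj (y n) * (B n n * y n))"
      using Suc.prems(2)[of _ n]
      by (simp add: sum.distrib sum_distrib_left d'_def mult_ac)
    then have "Re (\<Sum>i<Suc n. \<Sum>j<Suc n. cnj (y i) * (B i j * (of_real (d' j) * y j))) =
        Re (\<Sum>i<n. \<Sum>j<n. cnj (y i) * (B i j * (of_real (d' j) * y j))) +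
        e * Re (\<Sum>i<n. cnj (y i) * (B i n * y n)) + e * Re (cnj (y n) * (B n n * y n))"
      by (simp only: plus_complex.simps Re_complex_of_real Im_complex_of_real times_complex.simps)
    also have "\<dots> \<le> - \<mu> * S + (\<mu> * S / 2 + e * \<beta> * q / 2) + e * (- \<beta> * q)"
      using old col by (simp only: diag)
    also have "\<dots> = - (\<mu> / 2 * S + e * \<beta> / 2 * q)" by (simp add: field_simps)
    also have "\<dots> \<le> - (\<mu>' * S + \<mu>' * q)"
      using \<mu>' S q by (intro le_imp_neg_le add_mono mult_right_mono)
    finally show ?thesis by (simp add: S_def q_def ring_distribs)
  qed
  moreover have "\<forall>i<Suc n. 0 < d' i" using d e by (auto simp: d'_def less_Suc_eq)
  ultimately show ?case using \<mu>'(1) by blast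
qed

lemma vec_Re_mult:
  assumes A: "A \<in> carrier_mat n m" and h: "h \<in> carrier_vec m"
  shows "A *\<^sub>v map_vec Re h = map_vec Re (cmat A *\<^sub>v h)"
  by (rule eq_vecI) (use assms in \<open>simp_all add: scalar_prod_def\<close>)

lemma scalar_prod_map_Re:
  assumes "x \<in> carrier_vec n" "h \<in> carrier_vec n"
  shows "x \<bullet> map_vec Re h = Re (map_vec of_real x \<bullet> h)"
  using assms by (simp add: scalar_prod_def)

text \<open>Schur triangularization gives \<open>cmat A = P * B * Q\<close> with \<open>B\<close>
  upper triangular and \<open>Q\<close> inverse to \<open>P\<close>. With diagonal weights
  \<open>D\<close> from \<open>triangular_diagonal_lyapunov\<close>, the Hermitian product of
  \<open>P\<close>, \<open>D\<close> and the adjoint of \<open>P\<close> satisfies the inequality up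
  to scaling, and because \<open>A\<close> is real its real part does so on real vectors. The bound
  concerns \<open>A * X\<close>, the order in which the LMI contains \<open>X\<close>.\<close>

lemma hurwitz_lyapunov:
  assumes A: "A \<in> carrier_mat n n" and hurw: "hurwitz A"
  shows "\<exists>X\<in>carrier_mat n n. psd X \<and> (\<forall>x\<in>carrier_vec n. x \<bullet> (A *\<^sub>v (X *\<^sub>v x)) \<le> - (x \<bullet> x))"
proof -
  have cA: "cmat A \<in> carrier_mat n n" using A by simp
  obtain as where as: "char_poly (cmat A) = (\<Prod>a\<leftarrow>as. [:- a, 1:])"
    using char_poly_factorized[OF cA] by blast
  obtain B P Q where "schur_decomposition (cmat A) as = (B, P, Q)" by (cases "schur_decomposition (cmat A) as")
  from schur_decomposition[OF cA as this]
  have wit: "similar_mat_wit (cmat A) B P Q" and ut: "upper_triangular B" and diag: "diag_mat B = as"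
    by auto
  from similar_mat_witD2[OF cA wit]
  have PQ: "P * Q = 1\<^sub>m n" and QP: "Q * P = 1\<^sub>m n" and APQ: "cmat A = P * B * Q"
    and B: "B \<in> carrier_mat n n" and P: "P \<in> carrier_mat n n" and Q: "Q \<in> carrier_mat n n"
    by auto
  have AP: "cmat A * P = P * B"
    using P B Q by (simp add: APQ QP assoc_mult_mat[of _ n n _ n _ n])
  have "Re (B $$ (i, i)) < 0" if i: "i < n" for i
  proof -
    have "B $$ (i, i) \<in> set as" using i B by (auto simp: diag[symmetric] diag_mat_def)
    then have "poly (char_poly (cmat A)) (B $$ (i, i)) = 0"
      by (force simp: as poly_prod_list prod_list_zero_iff)
    then show ?thesis using hurw eigenvalue_root_char_poly[OF cA] by (simp add: hurwitz_def)
  qed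
  moreover have "B $$ (i, j) = 0" if "j < i" "i < n" for i j
    using ut B that by auto
  ultimately obtain d \<mu> where d: "\<And>i. i < n \<Longrightarrow> 0 < d i" and \<mu>: "0 < \<mu>"
    and neg: "\<And>y. Re (\<Sum>i<n. \<Sum>j<n. cnj (y i) * (B $$ (i, j) * (of_real (d j) * y j)))
      \<le> - \<mu> * (\<Sum>i<n. (cmod (y i))\<^sup>2)"
    using triangular_diagonal_lyapunov[of n "\<lambda>i j. B $$ (i, j)"] by blast
  \<comment> \<open>The squared Frobenius norm of \<open>Q\<close>: as \<open>Q\<close> inverts
    \<open>P\<close>, Cauchy-Schwarz will give \<open>x \<bullet> x \<le> k * S x\<close>. The
    \<open>+ 1\<close> makes \<open>k\<close> positive also for \<open>n = 0\<close>.\<close>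
  define k where "k = (\<Sum>i<n. \<Sum>j<n. (cmod (Q $$ (j, i)))\<^sup>2) + 1"
  have k: "0 < k" unfolding k_def by (intro add_nonneg_pos sum_nonneg) auto
  \<comment> \<open>The real part of \<open>P\<close> times the weights times the adjoint of
    \<open>P\<close>. Its decay is \<open>\<mu> * S x\<close>; the factor \<open>k / \<mu>\<close>
    in \<open>X\<close> turns this into at least \<open>x \<bullet> x\<close>.\<close>
  define X0 where "X0 = mat n n (\<lambda>(i, j). \<Sum>l<n. d l * Re (P $$ (i, l) * cnj (P $$ (j, l))))"
  define X where "X = (k / \<mu>) \<cdot>\<^sub>m X0"
  have X0: "X0 \<in> carrier_mat n n" and X: "X \<in> carrier_mat n n" by (simp_all add: X0_def X_def)
  define cv where "cv x = map_vec complex_of_real x" for x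
  \<comment> \<open>The adjoint of \<open>P\<close> applied to \<open>x\<close>: as \<open>x\<close>
    is real, the conjugation acts on \<open>P\<close> alone.\<close>
  define y where "y x l = cnj ((P\<^sup>T *\<^sub>v cv x) $ l)" for x l
  define S where "S x = (\<Sum>l<n. (cmod (y x l))\<^sup>2)" for x
  define h where "h x = vec n (\<lambda>l. of_real (d l) * y x l)" for x
  have h: "h x \<in> carrier_vec n" for x by (simp add: h_def)
  have cv: "cv x \<in> carrier_vec n" if "x \<in> carrier_vec n" for x using that by (simp add: cv_def)
  have Px: "P\<^sup>T *\<^sub>v cv x = vec n (\<lambda>l. cnj (y x l))" for x
    by (rule eq_vecI) (use P in \<open>auto simp: y_def\<close>)
  have yx: "y x l = (\<Sum>i<n. cnj (P $$ (i, l)) * of_real (x $ i))"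
    if "x \<in> carrier_vec n" "l < n" for x l
    using that P by (simp add: y_def cv_def scalar_prod_def atLeast0LessThan)
  have X0x: "X0 *\<^sub>v x = map_vec Re (P *\<^sub>v h x)" if x: "x \<in> carrier_vec n" for x
  proof (rule eq_vecI)
    fix i assume "i < dim_vec (map_vec Re (P *\<^sub>v h x))"
    then have i: "i < n" using P by simp
    have "(X0 *\<^sub>v x) $ i = (\<Sum>j<n. \<Sum>l<n. Re (P $$ (i, l) * (of_real (d l) * (cnj (P $$ (j, l)) * of_real (x $ j)))))"
      using i x by (simp add: X0_def scalar_prod_def atLeast0LessThan sum_distrib_left sum_distrib_right algebra_simps)
    also have "\<dots> = (\<Sum>l<n. Re (P $$ (i, l) * (of_real (d l) * y x l)))"
      by (subst sum.swap, rule sum.cong[OF refl]) (simp only: yx[OF x] lessThan_iff sum_distrib_left Re_sum)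
    also have "\<dots> = map_vec Re (P *\<^sub>v h x) $ i"
      using i P by (simp add: scalar_prod_def h_def atLeast0LessThan)
    finally show "(X0 *\<^sub>v x) $ i = map_vec Re (P *\<^sub>v h x) $ i" .
  qed (use P in \<open>simp add: X0_def\<close>)
  have pair: "cv x \<bullet> (P *\<^sub>v g) = (\<Sum>l<n. cnj (y x l) * g $ l)"
    if "x \<in> carrier_vec n" "g \<in> carrier_vec n" for x g
    using transpose_vec_mult_scalar[OF P that(2) cv[OF that(1)]] that(2)
    by (simp add: Px scalar_prod_def atLeast0LessThan)
  have "x \<bullet> (X0 *\<^sub>v x) = (\<Sum>l<n. d l * (cmod (y x l))\<^sup>2)" if x: "x \<in> carrier_vec n" for x
  proof -
    have "x \<bullet> (X0 *\<^sub>v x) = Re (cv x \<bullet> (P *\<^sub>v h x))"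
      using P h x by (simp add: X0x scalar_prod_map_Re[of _ n] cv_def)
    also have "\<dots> = (\<Sum>l<n. Re (cnj (y x l) * (of_real (d l) * y x l)))"
      by (simp only: pair[OF x h] Re_sum) (simp add: h_def)
    also have "\<dots> = (\<Sum>l<n. d l * (cmod (y x l))\<^sup>2)"
      by (intro sum.cong refl) (simp add: cmod_power2, simp add: power2_eq_square ring_distribs)
    finally show ?thesis .
  qed
  then have X0_pos: "0 \<le> x \<bullet> (X0 *\<^sub>v x)" if "x \<in> carrier_vec n" for x
    using that d by (auto intro!: sum_nonneg mult_nonneg_nonneg simp: less_imp_le)
  have "X\<^sup>T = X"
    by (rule eq_matI) (auto simp: X_def X0_def mult_ac)
  moreover have Xx: "X *\<^sub>v x = (k / \<mu>) \<cdot>\<^sub>v (X0 *\<^sub>v x)" if "x \<in> carrier_vec n" for x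
    by (rule eq_vecI) (use that X0 in \<open>simp_all add: X_def\<close>)
  ultimately have psd: "psd X"
    unfolding psd_def using X X0 X0_pos k \<mu> by (auto simp: Xx)
  have "x \<bullet> (A *\<^sub>v (X *\<^sub>v x)) \<le> - (x \<bullet> x)" if x: "x \<in> carrier_vec n" for x
  proof -
    have "x \<bullet> (A *\<^sub>v (X0 *\<^sub>v x)) = Re (cv x \<bullet> (cmat A *\<^sub>v (P *\<^sub>v h x)))"
      using A P h[of x] x by (simp add: X0x vec_Re_mult[of _ n n] scalar_prod_map_Re[of _ n] cv_def)
    also have "cmat A *\<^sub>v (P *\<^sub>v h x) = P *\<^sub>v (B *\<^sub>v h x)"
      using assoc_mult_mat_vec[OF cA P h, of x] assoc_mult_mat_vec[OF P B h, of x] by (simp add: AP)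
    also have "cv x \<bullet> (P *\<^sub>v (B *\<^sub>v h x)) = (\<Sum>i<n. cnj (y x i) * (B *\<^sub>v h x) $ i)"
      by (rule pair) (use x B h in simp_all)
    also have "\<dots> = (\<Sum>i<n. \<Sum>j<n. cnj (y x i) * (B $$ (i, j) * (of_real (d j) * y x j)))"
      using B by (simp add: scalar_prod_def h_def atLeast0LessThan sum_distrib_left)
    also have "Re \<dots> \<le> - \<mu> * S x" unfolding S_def by (rule neg)
    finally have decr: "x \<bullet> (A *\<^sub>v (X0 *\<^sub>v x)) \<le> - \<mu> * S x" .
    have "(x $ i)\<^sup>2 \<le> (\<Sum>j<n. (cmod (Q $$ (j, i)))\<^sup>2) * S x" if i: "i < n" for i
    proof -
      have "Q\<^sup>T *\<^sub>v (P\<^sup>T *\<^sub>v cv x) = cv x"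
        using P Q cv[OF x] assoc_mult_mat_vec[of "Q\<^sup>T" n n "P\<^sup>T" n "cv x"]
        by (simp add: transpose_mult[OF P Q, symmetric] PQ)
      then have "of_real (x $ i) = (Q\<^sup>T *\<^sub>v (P\<^sup>T *\<^sub>v cv x)) $ i"
        using i x by (simp add: cv_def)
      also have "\<dots> = (\<Sum>j<n. Q $$ (j, i) * cnj (y x j))"
        using i Q by (simp add: Px scalar_prod_def atLeast0LessThan)
      finally have "\<bar>x $ i\<bar> = cmod (\<Sum>j<n. Q $$ (j, i) * cnj (y x j))"
        by (metis norm_of_real)
      also have "\<dots> \<le> (\<Sum>j<n. cmod (Q $$ (j, i)) * cmod (y x j))"
        by (rule order_trans[OF norm_sum]) (simp add: norm_mult)
      finally have "\<bar>x $ i\<bar>\<^sup>2 \<le> (\<Sum>j<n. cmod (Q $$ (j, i)) * cmod (y x j))\<^sup>2"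
        by (rule power_mono) simp
      also have "\<dots> \<le> (\<Sum>j<n. (cmod (Q $$ (j, i)))\<^sup>2) * S x"
        unfolding S_def by (rule Cauchy_Schwarz_ineq_sum)
      finally show ?thesis by simp
    qed
    then have "x \<bullet> x \<le> (\<Sum>i<n. (\<Sum>j<n. (cmod (Q $$ (j, i)))\<^sup>2) * S x)"
      unfolding scalar_prod_self[OF x] by (intro sum_mono) simp
    also have "\<dots> \<le> k * S x"
      by (simp add: k_def sum_distrib_right ring_distribs S_def sum_nonneg)
    finally have "x \<bullet> x \<le> k * S x" .
    moreover have "x \<bullet> (A *\<^sub>v (X *\<^sub>v x)) = k / \<mu> * (x \<bullet> (A *\<^sub>v (X0 *\<^sub>v x)))"
      using A X0 x by (simp add: Xx mult_mat_vec[of _ n n])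
    moreover have "k / \<mu> * (x \<bullet> (A *\<^sub>v (X0 *\<^sub>v x))) \<le> k / \<mu> * (- \<mu> * S x)"
      using decr k \<mu> by (intro mult_left_mono) simp_all
    ultimately show ?thesis using \<mu> by simp
  qed
  then show ?thesis using X psd by blast
qed

section \<open>Strict feasibility of the LMI\<close>

text \<open>The quadratic form of the LMI matrix at \<open>(x, z, w)\<close>, without the two blocks that
  contain the performance level.\<close>

definition lmi_form ::
  "real mat \<Rightarrow> real mat \<Rightarrow> real mat \<Rightarrow> real mat \<Rightarrow> real mat \<Rightarrow> real mat \<Rightarrow> real mat \<Rightarrow> real mat
    \<Rightarrow> real vec \<Rightarrow> real vec \<Rightarrow> real vec \<Rightarrow> real" where
  "lmi_form A B1 B2 C D1 D2 X Y x z w =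
     2 * (x \<bullet> (A *\<^sub>v (X *\<^sub>v x)) + x \<bullet> (B2 *\<^sub>v (Y *\<^sub>v x))) +
     2 * (z \<bullet> (C *\<^sub>v (X *\<^sub>v x)) + z \<bullet> (D2 *\<^sub>v (Y *\<^sub>v x))) +
     2 * (x \<bullet> (B1 *\<^sub>v w)) + 2 * (z \<bullet> (D1 *\<^sub>v w))"

lemma psd_lmi_matrix_iff_form:
  assumes "A \<in> carrier_mat n n" "B1 \<in> carrier_mat n m" "B2 \<in> carrier_mat n q"
    and "C \<in> carrier_mat p n" "D1 \<in> carrier_mat p m" "D2 \<in> carrier_mat p q"
    and "X \<in> carrier_mat n n" "Y \<in> carrier_mat q n"
  shows "psd (- lmi_matrix A B1 B2 C D1 D2 g X Y) \<longleftrightarrow>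
    (\<forall>x\<in>carrier_vec n. \<forall>z\<in>carrier_vec p. \<forall>w\<in>carrier_vec m.
      lmi_form A B1 B2 C D1 D2 X Y x z w \<le> g * (z \<bullet> z + w \<bullet> w))"
proof -
  have "x \<bullet> ((A * X + B2 * Y) *\<^sub>v x) = x \<bullet> (A *\<^sub>v (X *\<^sub>v x)) + x \<bullet> (B2 *\<^sub>v (Y *\<^sub>v x))"
    if "x \<in> carrier_vec n" for x
    using assms that
    by (simp add: add_mult_distrib_mat_vec[of _ n n] scalar_prod_add_distrib[of _ n]
        assoc_mult_mat_vec[of _ n n _ n] assoc_mult_mat_vec[of _ n q _ n])
  moreover have "z \<bullet> ((C * X + D2 * Y) *\<^sub>v x) = z \<bullet> (C *\<^sub>v (X *\<^sub>v x)) + z \<bullet> (D2 *\<^sub>v (Y *\<^sub>v x))"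
    if "x \<in> carrier_vec n" "z \<in> carrier_vec p" for x z
    using assms that
    by (simp add: add_mult_distrib_mat_vec[of _ p n] scalar_prod_add_distrib[of _ p]
        assoc_mult_mat_vec[of _ p n _ n] assoc_mult_mat_vec[of _ p q _ n])
  ultimately show ?thesis
    unfolding psd_lmi_matrix_iff[OF assms] lmi_form_def by simp
qed

lemma psd_congruence:
  assumes X: "X \<in> carrier_mat n n" and M: "M \<in> carrier_mat l n" and psd: "psd X"
  shows "psd (M * X * M\<^sup>T)"
proof -
  have sym: "X\<^sup>T = X" and pos: "\<And>v. v \<in> carrier_vec n \<Longrightarrow> 0 \<le> v \<bullet> (X *\<^sub>v v)"
    using psd X by (auto simp: psd_def)
  have MX: "M * X \<in> carrier_mat l n" and MT: "M\<^sup>T \<in> carrier_mat n l" using M X by simp_all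
  have XM: "X * M\<^sup>T \<in> carrier_mat n l" using X MT by simp
  have "(M * X * M\<^sup>T)\<^sup>T = M * (X * M\<^sup>T)"
    by (simp only: transpose_mult[OF MX MT] transpose_mult[OF M X] sym transpose_transpose)
  also have "\<dots> = M * X * M\<^sup>T" by (simp only: assoc_mult_mat[OF M X MT])
  finally have "(M * X * M\<^sup>T)\<^sup>T = M * X * M\<^sup>T" .
  moreover have "v \<bullet> (M * X * M\<^sup>T *\<^sub>v v) = (M\<^sup>T *\<^sub>v v) \<bullet> (X *\<^sub>v (M\<^sup>T *\<^sub>v v))"
    if v: "v \<in> carrier_vec l" for v
  proof -
    have u: "M\<^sup>T *\<^sub>v v \<in> carrier_vec n" using MT v by simp
    have "M * X * M\<^sup>T *\<^sub>v v = M *\<^sub>v (X *\<^sub>v (M\<^sup>T *\<^sub>v v))"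
      by (simp only: assoc_mult_mat_vec[OF MX MT v] assoc_mult_mat_vec[OF M X u])
    then show ?thesis using transpose_vec_mult_scalar[OF M _ v] X u by simp
  qed
  ultimately show ?thesis unfolding psd_def using M MT pos by auto
qed

lemma psd_add:
  assumes "X \<in> carrier_mat n n" "Y \<in> carrier_mat n n" "psd X" "psd Y"
  shows "psd (X + Y)"
  using assms unfolding psd_def
  by (auto simp: transpose_add[of _ n n] add_mult_distrib_mat_vec[of _ n n] scalar_prod_add_distrib[of _ n])

lemma smult_mat_mult_vec:
  fixes X :: "'a::comm_ring_1 mat"
  assumes "X \<in> carrier_mat l n" "x \<in> carrier_vec n"
  shows "(c \<cdot>\<^sub>m X) *\<^sub>v x = c \<cdot>\<^sub>v (X *\<^sub>v x)"
  by (rule eq_vecI) (use assms in simp_all)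

lemma transpose_smult: "(c \<cdot>\<^sub>m X)\<^sup>T = c \<cdot>\<^sub>m X\<^sup>T"
  by (rule eq_matI) simp_all

lemma psd_smult:
  assumes "X \<in> carrier_mat n n" "psd X" "0 \<le> c"
  shows "psd (c \<cdot>\<^sub>m X)"
  using assms unfolding psd_def
  by (auto simp: smult_mat_mult_vec[of _ n n] transpose_smult)

lemma psd_one: "psd (1\<^sub>m n)"
  by (simp add: psd_def scalar_prod_self_nonneg)

text \<open>The form is linear in \<open>(X, Y)\<close>. Moving by \<open>d\<close> in the direction
  \<open>(L, F * L)\<close>, with \<open>L\<close> a Lyapunov matrix of \<open>A + B2 * F\<close>,
  changes the state block by at most \<open>- 2 * d * (x \<bullet> x)\<close>. The only other change
  is an output cross term; Young's inequality with weight 1 lets it consume one of the two copies of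
  \<open>d * (x \<bullet> x)\<close> and a multiple of \<open>z \<bullet> z\<close>.\<close>

lemma lmi_strictly_feasible:
  assumes A: "A \<in> carrier_mat n n" and B1: "B1 \<in> carrier_mat n m" and B2: "B2 \<in> carrier_mat n q"
    and C: "C \<in> carrier_mat p n" and D1: "D1 \<in> carrier_mat p m" and D2: "D2 \<in> carrier_mat p q"
    and X: "X \<in> carrier_mat n n" "psd X" and Y: "Y \<in> carrier_mat q n"
    and F: "F \<in> carrier_mat q n" "hurwitz (A + B2 * F)"
    and feas: "\<And>x z w. x \<in> carrier_vec n \<Longrightarrow> z \<in> carrier_vec p \<Longrightarrow> w \<in> carrier_vec m \<Longrightarrow>
      lmi_form A B1 B2 C D1 D2 X Y x z w \<le> g * (z \<bullet> z + w \<bullet> w)"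
    and e: "0 < e"
  shows "\<exists>X'\<in>carrier_mat n n. \<exists>Y'\<in>carrier_mat q n. \<exists>d>0. psd X' \<and>
    (\<forall>x\<in>carrier_vec n. \<forall>z\<in>carrier_vec p. \<forall>w\<in>carrier_vec m.
      lmi_form A B1 B2 C D1 D2 X' Y' x z w \<le> (g + e) * (z \<bullet> z + w \<bullet> w) - d * (x \<bullet> x))"
proof -
  have "A + B2 * F \<in> carrier_mat n n" using A B2 F by simp
  from hurwitz_lyapunov[OF this F(2)] obtain L where L: "L \<in> carrier_mat n n" "psd L"
    and lyap: "\<And>x. x \<in> carrier_vec n \<Longrightarrow> x \<bullet> ((A + B2 * F) *\<^sub>v (L *\<^sub>v x)) \<le> - (x \<bullet> x)"
    by blast
  have CF: "C + D2 * F \<in> carrier_mat p n" using C D2 F by simp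
  then have CFL: "(C + D2 * F) * L \<in> carrier_mat p n" using L by simp
  obtain c where c: "0 \<le> c"
    and young: "\<And>z x. z \<in> carrier_vec p \<Longrightarrow> x \<in> carrier_vec n \<Longrightarrow>
      2 * (z \<bullet> ((C + D2 * F) * L *\<^sub>v x)) \<le> c * (z \<bullet> z) + 1 * (x \<bullet> x)"
    by (rule mat_form_young[OF CFL, of 1]) (simp, blast)
  \<comment> \<open>The cross term costs \<open>d * c * (z \<bullet> z)\<close>, which has to fit
    into the increase \<open>e\<close> of the level.\<close>
  define d where "d = e / (c + 1)"
  have d: "0 < d" and dc: "d * c \<le> e" using e c by (simp_all add: d_def field_simps)
  define X' where "X' = X + d \<cdot>\<^sub>m L"
  define Y' where "Y' = Y + d \<cdot>\<^sub>m (F * L)"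
  have X': "X' \<in> carrier_mat n n" and Y': "Y' \<in> carrier_mat q n"
    using X Y F L by (simp_all add: X'_def Y'_def)
  have psd': "psd X'"
    unfolding X'_def using X L d by (intro psd_add[of _ n] psd_smult[of _ n]) simp_all
  have "lmi_form A B1 B2 C D1 D2 X' Y' x z w \<le> (g + e) * (z \<bullet> z + w \<bullet> w) - d * (x \<bullet> x)"
    if x: "x \<in> carrier_vec n" and z: "z \<in> carrier_vec p" and w: "w \<in> carrier_vec m" for x z w
  proof -
    define u where "u = L *\<^sub>v x"
    have u: "u \<in> carrier_vec n" using L x by (simp add: u_def)
    have Xx: "X *\<^sub>v x \<in> carrier_vec n" and Yx: "Y *\<^sub>v x \<in> carrier_vec q" and Fu: "F *\<^sub>v u \<in> carrier_vec q"
      using X Y F x u by simp_all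
    have X'x: "X' *\<^sub>v x = X *\<^sub>v x + d \<cdot>\<^sub>v u"
      using X L x by (simp add: X'_def u_def add_mult_distrib_mat_vec[of _ n n] smult_mat_mult_vec[of _ n n])
    have "(F * L) *\<^sub>v x = F *\<^sub>v u" using F L x by (simp add: u_def assoc_mult_mat_vec[of _ q n _ n])
    then have Y'x: "Y' *\<^sub>v x = Y *\<^sub>v x + d \<cdot>\<^sub>v (F *\<^sub>v u)"
      using Y F L x by (simp add: Y'_def add_mult_distrib_mat_vec[of _ q n] smult_mat_mult_vec[of _ q n])
    have lin: "v \<bullet> (M *\<^sub>v (a + d \<cdot>\<^sub>v b)) = v \<bullet> (M *\<^sub>v a) + d * (v \<bullet> (M *\<^sub>v b))"
      if "M \<in> carrier_mat i j" "v \<in> carrier_vec i" "a \<in> carrier_vec j" "b \<in> carrier_vec j" for M i j v a b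
      using that by (simp add: mult_add_distrib_mat_vec[of _ i j] mult_mat_vec[of _ i j] scalar_prod_add_distrib[of _ i])
    have form: "lmi_form A B1 B2 C D1 D2 X' Y' x z w = lmi_form A B1 B2 C D1 D2 X Y x z w +
        2 * d * (x \<bullet> (A *\<^sub>v u) + x \<bullet> (B2 *\<^sub>v (F *\<^sub>v u))) +
        d * (2 * (z \<bullet> (C *\<^sub>v u) + z \<bullet> (D2 *\<^sub>v (F *\<^sub>v u))))"
      by (simp add: lmi_form_def X'x Y'x lin[OF A x Xx u] lin[OF B2 x Yx Fu] lin[OF C z Xx u]
          lin[OF D2 z Yx Fu] ring_distribs)
    have "x \<bullet> (A *\<^sub>v u) + x \<bullet> (B2 *\<^sub>v (F *\<^sub>v u)) = x \<bullet> ((A + B2 * F) *\<^sub>v u)"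
      using A B2 F x u
      by (simp add: add_mult_distrib_mat_vec[of _ n n] scalar_prod_add_distrib[of _ n] assoc_mult_mat_vec[of _ n q _ n])
    then have 1: "x \<bullet> (A *\<^sub>v u) + x \<bullet> (B2 *\<^sub>v (F *\<^sub>v u)) \<le> - (x \<bullet> x)"
      using lyap[OF x] by (simp add: u_def)
    have "(C + D2 * F) * L *\<^sub>v x = (C + D2 * F) *\<^sub>v u"
      unfolding u_def by (rule assoc_mult_mat_vec[OF CF L(1) x])
    moreover have "z \<bullet> ((C + D2 * F) *\<^sub>v u) = z \<bullet> (C *\<^sub>v u) + z \<bullet> (D2 *\<^sub>v (F *\<^sub>v u))"
      using C D2 F z u
      by (simp add: add_mult_distrib_mat_vec[of _ p n] scalar_prod_add_distrib[of _ p] assoc_mult_mat_vec[of _ p q _ n])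
    ultimately have 2: "2 * (z \<bullet> (C *\<^sub>v u) + z \<bullet> (D2 *\<^sub>v (F *\<^sub>v u))) \<le> c * (z \<bullet> z) + x \<bullet> x"
      using young[OF z x] by simp
    have "d * (c * (z \<bullet> z) + x \<bullet> x) \<le> e * (z \<bullet> z + w \<bullet> w) + d * (x \<bullet> x)"
    proof -
      have "d * c * (z \<bullet> z) \<le> e * (z \<bullet> z)" using dc by (intro mult_right_mono scalar_prod_self_nonneg)
      moreover have "0 \<le> e * (w \<bullet> w)" using e scalar_prod_self_nonneg[of w] by simp
      ultimately show ?thesis by (simp add: ring_distribs mult.assoc)
    qed
    moreover have "2 * d * (x \<bullet> (A *\<^sub>v u) + x \<bullet> (B2 *\<^sub>v (F *\<^sub>v u))) \<le> 2 * d * - (x \<bullet> x)"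
      using 1 d by (intro mult_left_mono) simp_all
    moreover have "d * (2 * (z \<bullet> (C *\<^sub>v u) + z \<bullet> (D2 *\<^sub>v (F *\<^sub>v u)))) \<le> d * (c * (z \<bullet> z) + x \<bullet> x)"
      using 2 d by (intro mult_left_mono) simp_all
    ultimately show ?thesis using feas[OF x z w] unfolding form by (simp add: ring_distribs)
  qed
  then show ?thesis using X' Y' psd' d by blast
qed

section \<open>Deflation of invariant zeros\<close>

lemma mat_diag_mult_vec:
  assumes "a \<in> carrier_vec r"
  shows "mat_diag r f *\<^sub>v a = vec r (\<lambda>i. f i * a $ i)"
proof (rule eq_vecI)
  fix i assume "i < dim_vec (vec r (\<lambda>i. f i * a $ i))"
  then have i: "i < r" by simp
  then have "(mat_diag r f *\<^sub>v a) $ i = (\<Sum>j = 0..<r. (if i = j then f j else 0) * a $ j)"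
    using assms by (simp add: mat_diag_def scalar_prod_def)
  also have "\<dots> = (\<Sum>j = 0..<r. if i = j then f j * a $ j else 0)"
    by (intro sum.cong) auto
  finally have "(mat_diag r f *\<^sub>v a) $ i = (\<Sum>j = 0..<r. if i = j then f j * a $ j else 0)" .
  then show "(mat_diag r f *\<^sub>v a) $ i = vec r (\<lambda>i. f i * a $ i) $ i" using i by simp
qed (simp add: mat_diag_def)

lemma mat_diag_form_le:
  fixes lam :: "nat \<Rightarrow> real"
  assumes "\<And>i. i < r \<Longrightarrow> lam i < 0"
  shows "\<exists>\<mu>>0. \<forall>a\<in>carrier_vec r. a \<bullet> (mat_diag r lam *\<^sub>v a) \<le> - \<mu> * (a \<bullet> a)"
proof -
  have "\<exists>\<mu>>0. \<forall>i<r. lam i \<le> - \<mu>"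
    using assms
  proof (induction r)
    case 0
    show ?case by (intro exI[of _ 1]) simp
  next
    case (Suc r)
    then obtain \<mu> where "0 < \<mu>" "\<forall>i<r. lam i \<le> - \<mu>" by auto
    then show ?case using Suc.prems[of r]
      by (intro exI[of _ "min \<mu> (- lam r)"]) (auto simp: less_Suc_eq)
  qed
  then obtain \<mu> where \<mu>: "0 < \<mu>" "\<And>i. i < r \<Longrightarrow> lam i \<le> - \<mu>" by blast
  have "a \<bullet> (mat_diag r lam *\<^sub>v a) \<le> - \<mu> * (a \<bullet> a)" if a: "a \<in> carrier_vec r" for a
  proof -
    have "a \<bullet> (mat_diag r lam *\<^sub>v a) = (\<Sum>i<r. lam i * (a $ i)\<^sup>2)"
      using a by (simp add: mat_diag_mult_vec scalar_prod_def atLeast0LessThan power2_eq_square mult_ac)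
    also have "\<dots> \<le> (\<Sum>i<r. - \<mu> * (a $ i)\<^sup>2)"
      by (intro sum_mono mult_right_mono) (simp_all add: \<mu>)
    also have "\<dots> = - \<mu> * (a \<bullet> a)" unfolding scalar_prod_self[OF a] sum_distrib_left ..
    finally show ?thesis .
  qed
  then show ?thesis using \<mu>(1) by blast
qed

text \<open>\<open>(H, J)\<close> is the coordinate change \<open>T\<close> and \<open>(P; E)\<close> its inverse; \<open>A12\<close>, \<open>A22\<close>, \<open>B11\<close>,
  \<open>B12\<close>, \<open>B21\<close>, \<open>B22\<close>, \<open>C2\<close> are the blocks of the transformed system.\<close>

locale zero_deflation =
  fixes n m q p r k :: nat
    and A B1 B2 C D1 D2 H J P E R A12 A22 B11 B12 B21 B22 C2 :: "real mat"
    and lam :: "nat \<Rightarrow> real"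
  assumes A: "A \<in> carrier_mat n n" and B1: "B1 \<in> carrier_mat n m" and B2: "B2 \<in> carrier_mat n q"
    and C: "C \<in> carrier_mat p n" and D1: "D1 \<in> carrier_mat p m" and D2: "D2 \<in> carrier_mat p q"
    and H: "H \<in> carrier_mat n r" and J: "J \<in> carrier_mat n k"
    and P: "P \<in> carrier_mat r n" and E: "E \<in> carrier_mat k n" and R: "R \<in> carrier_mat q r"
    and A12: "A12 \<in> carrier_mat r k" and A22: "A22 \<in> carrier_mat k k"
    and B11: "B11 \<in> carrier_mat r m" and B12: "B12 \<in> carrier_mat k m"
    and B21: "B21 \<in> carrier_mat r q" and B22: "B22 \<in> carrier_mat k q"
    and C2: "C2 \<in> carrier_mat p k"
    and HP_JE: "H * P + J * E = 1\<^sub>m n"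
    and PH: "P * H = 1\<^sub>m r" and EH: "E * H = 0\<^sub>m k r" and EJ: "E * J = 1\<^sub>m k"
    and AH: "A * H + B2 * R = H * mat_diag r lam"
    and CH: "C * H + D2 * R = 0\<^sub>m p r"
    and AJ: "A * J = H * A12 + J * A22"
    and CJ: "C * J = C2"
    and B1_split: "B1 = H * B11 + J * B12" and B2_split: "B2 = H * B21 + J * B22"
    and lam: "\<And>i. i < r \<Longrightarrow> lam i < 0"
begin

section \<open>The quotient map \<open>E\<close> and the matrices induced on the quotient\<close>

lemma mult_split:
  assumes M: "M \<in> carrier_mat l n"
  shows "M = (M * H) * P + (M * J) * E"
proof -
  have "M = M * (H * P + J * E)" using M by (simp add: HP_JE)
  also have "\<dots> = M * (H * P) + M * (J * E)"
    by (rule mult_add_distrib_mat[OF M mult_carrier_mat[OF H P] mult_carrier_mat[OF J E]])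
  also have "\<dots> = (M * H) * P + (M * J) * E"
    by (simp only: assoc_mult_mat[OF M H P] assoc_mult_mat[OF M J E])
  finally show ?thesis .
qed

lemma E_mult_split:
  assumes "M1 \<in> carrier_mat r l" "M2 \<in> carrier_mat k l"
  shows "E * (H * M1 + J * M2) = M2"
proof -
  have "E * (H * M1 + J * M2) = E * (H * M1) + E * (J * M2)"
    by (rule mult_add_distrib_mat[OF E mult_carrier_mat[OF H assms(1)] mult_carrier_mat[OF J assms(2)]])
  also have "\<dots> = (E * H) * M1 + (E * J) * M2"
    by (simp only: assoc_mult_mat[OF E H assms(1)] assoc_mult_mat[OF E J assms(2)])
  finally show ?thesis using assms by (simp add: EH EJ)
qed

lemma E_B1: "E * B1 = B12"
  unfolding B1_split by (rule E_mult_split[OF B11 B12])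

lemma E_B2: "E * B2 = B22"
  unfolding B2_split by (rule E_mult_split[OF B21 B22])

text \<open>As \<open>B22 = E * B2\<close>, this says that \<open>E\<close> intertwines
  \<open>A + B2 * (R * P)\<close> with \<open>A22\<close>. Splitting along
  \<open>H * P + J * E\<close>, the part through \<open>P\<close> vanishes because \<open>E\<close>
  kills \<open>A * H + B2 * R = H * mat_diag r lam\<close>, and the part through \<open>E\<close> is
  \<open>E * A * J = A22\<close>.\<close>

lemma E_A: "E * A + B22 * (R * P) = A22 * E"
proof -
  have AH': "A * H \<in> carrier_mat n r" and BR: "B2 * R \<in> carrier_mat n r"
    and EA: "E * A \<in> carrier_mat k n" and BR': "B22 * R \<in> carrier_mat k r"
    and EAH: "E * (A * H) \<in> carrier_mat k r" and diag: "mat_diag r lam \<in> carrier_mat r r"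
    using A H B2 R E B22 by simp_all
  have EAJ: "E * (A * J) = A22"
    unfolding AJ by (rule E_mult_split[OF A12 A22])
  have "E * (A * H) + B22 * R = E * (A * H) + E * (B2 * R)"
    by (simp only: E_B2[symmetric] assoc_mult_mat[OF E B2 R])
  also have "\<dots> = E * (A * H + B2 * R)"
    by (simp only: mult_add_distrib_mat[OF E AH' BR])
  also have "\<dots> = (E * H) * mat_diag r lam"
    unfolding AH by (simp only: assoc_mult_mat[OF E H diag])
  also have "\<dots> = 0\<^sub>m k r" by (simp only: EH left_mult_zero_mat[OF diag])
  finally have 0: "E * (A * H) + B22 * R = 0\<^sub>m k r" .
  have "E * A = (E * (A * H)) * P + A22 * E"
    using mult_split[OF EA] by (simp only: assoc_mult_mat[OF E A H] assoc_mult_mat[OF E A J] EAJ)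
  moreover have "B22 * (R * P) = (B22 * R) * P"
    by (simp only: assoc_mult_mat[OF B22 R P])
  ultimately have "E * A + B22 * (R * P) = ((E * (A * H)) * P + A22 * E) + (B22 * R) * P"
    by simp
  also have "\<dots> = ((E * (A * H)) * P + (B22 * R) * P) + A22 * E"
    by (rule eq_matI) (use A22 E B22 R P A H in simp_all)
  also have "\<dots> = (E * (A * H) + B22 * R) * P + A22 * E"
    by (simp only: add_mult_distrib_mat[OF EAH BR' P])
  also have "\<dots> = A22 * E" using P A22 E by (simp add: 0)
  finally show ?thesis .
qed

text \<open>The preliminary feedback makes the range of \<open>H\<close> invisible at the output
  (\<open>CH\<close>), so the output matrix factors through the quotient map.\<close>

lemma C_eq: "C + D2 * (R * P) = C2 * E"
proof -
  have CH': "C * H \<in> carrier_mat p r" and DR: "D2 * R \<in> carrier_mat p r" using C H D2 R by simp_all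
  have "C + D2 * (R * P) = ((C * H) * P + C2 * E) + (D2 * R) * P"
    using mult_split[OF C] by (simp only: CJ assoc_mult_mat[OF D2 R P])
  also have "\<dots> = ((C * H) * P + (D2 * R) * P) + C2 * E"
    by (rule eq_matI) (use C2 E P C H D2 R in simp_all)
  also have "\<dots> = (C * H + D2 * R) * P + C2 * E"
    by (simp only: add_mult_distrib_mat[OF CH' DR P])
  also have "\<dots> = C2 * E" using P C2 E by (simp add: CH)
  finally show ?thesis .
qed

lemma E_A_vec:
  assumes u: "u \<in> carrier_vec n"
  shows "A22 *\<^sub>v (E *\<^sub>v u) = E *\<^sub>v (A *\<^sub>v u) + B22 *\<^sub>v (R *\<^sub>v (P *\<^sub>v u))"
proof -
  have "A22 *\<^sub>v (E *\<^sub>v u) = (E * A + B22 * (R * P)) *\<^sub>v u"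
    using A22 E u by (simp add: E_A)
  also have "\<dots> = (E * A) *\<^sub>v u + (B22 * (R * P)) *\<^sub>v u"
    using A E B22 R P u by (simp add: add_mult_distrib_mat_vec[of _ k n])
  finally show ?thesis
    using A E B22 R P u
    by (simp add: assoc_mult_mat_vec[of _ k n _ n] assoc_mult_mat_vec[of _ k q _ n] assoc_mult_mat_vec[of _ q r _ n])
qed

lemma C_eq_vec:
  assumes u: "u \<in> carrier_vec n"
  shows "C2 *\<^sub>v (E *\<^sub>v u) = C *\<^sub>v u + D2 *\<^sub>v (R *\<^sub>v (P *\<^sub>v u))"
proof -
  have "C2 *\<^sub>v (E *\<^sub>v u) = (C + D2 * (R * P)) *\<^sub>v u"
    using C2 E u by (simp add: C_eq)
  also have "\<dots> = C *\<^sub>v u + (D2 * (R * P)) *\<^sub>v u"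
    using C D2 R P u by (simp add: add_mult_distrib_mat_vec[of _ p n])
  finally show ?thesis
    using D2 R P u
    by (simp add: assoc_mult_mat_vec[of _ p q _ n] assoc_mult_mat_vec[of _ q r _ n])
qed

text \<open>By \<open>E_A\<close>, \<open>A22 * E\<close> already contains the feedback
  \<open>R * P\<close>, so this feedback is subtracted from \<open>Y\<close>. Then
  \<open>A22 * X' + B22 * Y'\<close> equals \<open>E * (A * X + B2 * Y) * E\<^sup>T\<close>, and the
  output row becomes \<open>(C * X + D2 * Y) * E\<^sup>T\<close>. The reduced form at
  \<open>(x, z, w)\<close> is therefore the full form at
  \<open>(E\<^sup>T *\<^sub>v x, z, w)\<close>, and the level is kept exactly.\<close>

lemma lmi_restrict:
  assumes X: "X \<in> carrier_mat n n" "psd X" and Y: "Y \<in> carrier_mat q n"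
    and feas: "psd (- lmi_matrix A B1 B2 C D1 D2 g X Y)"
  shows "\<exists>X'\<in>carrier_mat k k. \<exists>Y'\<in>carrier_mat q k. psd X' \<and>
    psd (- lmi_matrix A22 B12 B22 C2 D1 D2 g X' Y')"
proof -
  define X' where "X' = E * X * E\<^sup>T"
  define Y' where "Y' = (Y - R * (P * X)) * E\<^sup>T"
  have ET: "E\<^sup>T \<in> carrier_mat n k" using E by simp
  have X': "X' \<in> carrier_mat k k" using X E by (simp add: X'_def)
  have PX: "P * X \<in> carrier_mat r n" using P X by simp
  have YR: "Y - R * (P * X) \<in> carrier_mat q n" using Y R PX by (simp add: minus_carrier_mat)
  have Y': "Y' \<in> carrier_mat q k" unfolding Y'_def by (rule mult_carrier_mat[OF YR ET])
  have form: "lmi_form A22 B12 B22 C2 D1 D2 X' Y' x z w = lmi_form A B1 B2 C D1 D2 X Y (E\<^sup>T *\<^sub>v x) z w"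
    if x: "x \<in> carrier_vec k" and z: "z \<in> carrier_vec p" and w: "w \<in> carrier_vec m" for x z w
  proof -
    define y where "y = E\<^sup>T *\<^sub>v x"
    define u where "u = X *\<^sub>v y"
    define v where "v = Y *\<^sub>v y"
    define s where "s = R *\<^sub>v (P *\<^sub>v u)"
    have y: "y \<in> carrier_vec n" and u: "u \<in> carrier_vec n" and v: "v \<in> carrier_vec q" and s: "s \<in> carrier_vec q"
      using ET x X Y R P by (simp_all add: y_def u_def v_def s_def)
    have EX: "E * X \<in> carrier_mat k n" using E X by simp
    have X'x: "X' *\<^sub>v x = E *\<^sub>v u"
      unfolding X'_def u_def y_def
      using assoc_mult_mat_vec[OF EX ET x] assoc_mult_mat_vec[OF E X(1), of "E\<^sup>T *\<^sub>v x"] ET x by simp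
    have "Y' *\<^sub>v x = (Y - R * (P * X)) *\<^sub>v y"
      unfolding Y'_def y_def by (rule assoc_mult_mat_vec[OF YR ET x])
    also have "\<dots> = v - (R * (P * X)) *\<^sub>v y"
      unfolding v_def by (rule minus_mult_distrib_mat_vec[OF Y mult_carrier_mat[OF R PX] y])
    also have "(R * (P * X)) *\<^sub>v y = s"
      unfolding s_def u_def by (simp only: assoc_mult_mat_vec[OF R PX y] assoc_mult_mat_vec[OF P X(1) y])
    finally have Y'x: "Y' *\<^sub>v x = v - s" .
    have move: "x \<bullet> (E *\<^sub>v t) = y \<bullet> t" if "t \<in> carrier_vec n" for t
      unfolding y_def using transpose_vec_mult_scalar[OF E that x] by simp
    have B2': "x \<bullet> (B22 *\<^sub>v t) = y \<bullet> (B2 *\<^sub>v t)" if "t \<in> carrier_vec q" for t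
      using move[of "B2 *\<^sub>v t"] B2 that by (simp add: E_B2[symmetric] assoc_mult_mat_vec[OF E B2 that])
    have B1': "x \<bullet> (B12 *\<^sub>v w) = y \<bullet> (B1 *\<^sub>v w)"
      using move[of "B1 *\<^sub>v w"] B1 w by (simp add: E_B1[symmetric] assoc_mult_mat_vec[OF E B1 w])
    have "x \<bullet> (A22 *\<^sub>v (E *\<^sub>v u)) = y \<bullet> (A *\<^sub>v u) + x \<bullet> (B22 *\<^sub>v s)"
      unfolding E_A_vec[OF u] s_def[symmetric]
      using A E B22 u s x by (simp add: scalar_prod_add_distrib[of _ k] move)
    moreover have "x \<bullet> (B22 *\<^sub>v (v - s)) = x \<bullet> (B22 *\<^sub>v v) - x \<bullet> (B22 *\<^sub>v s)"
      using B22 v s x by (simp add: mult_minus_distrib_mat_vec[of _ k q] scalar_prod_minus_distrib[of _ k])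
    moreover have "z \<bullet> (C2 *\<^sub>v (E *\<^sub>v u)) = z \<bullet> (C *\<^sub>v u) + z \<bullet> (D2 *\<^sub>v s)"
      unfolding C_eq_vec[OF u] s_def[symmetric]
      using C D2 u s z by (simp add: scalar_prod_add_distrib[of _ p])
    moreover have "z \<bullet> (D2 *\<^sub>v (v - s)) = z \<bullet> (D2 *\<^sub>v v) - z \<bullet> (D2 *\<^sub>v s)"
      using D2 v s z by (simp add: mult_minus_distrib_mat_vec[of _ p q] scalar_prod_minus_distrib[of _ p])
    ultimately show ?thesis
      using B2'[OF v] B1' by (simp add: lmi_form_def X'x Y'x y_def[symmetric] u_def[symmetric] v_def[symmetric])
  qed
  have "psd X'" unfolding X'_def by (rule psd_congruence[OF X(1) E X(2)])
  moreover have "psd (- lmi_matrix A22 B12 B22 C2 D1 D2 g X' Y')"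
    unfolding psd_lmi_matrix_iff_form[OF A22 B12 B22 C2 D1 D2 X' Y']
    using feas[unfolded psd_lmi_matrix_iff_form[OF A B1 B2 C D1 D2 X(1) Y]] ET by (simp add: form)
  ultimately show ?thesis using X' Y' by blast
qed

text \<open>In the coordinates of \<open>T\<close>, \<open>A * X' + B2 * Y'\<close> is block upper
  triangular: diagonal blocks \<open>t\<close> times \<open>mat_diag r lam\<close> and
  \<open>A22 * X2 + B22 * Y2\<close>, coupling block \<open>G\<close>. The stabilizing gain
  \<open>F\<close> serves to make the second diagonal block strict first.\<close>

lemma lmi_extend:
  assumes X: "X \<in> carrier_mat k k" "psd X" and Y: "Y \<in> carrier_mat q k"
    and F: "F \<in> carrier_mat q k" "hurwitz (A22 + B22 * F)"
    and feas: "psd (- lmi_matrix A22 B12 B22 C2 D1 D2 g X Y)" and e: "0 < e"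
  shows "\<exists>X'\<in>carrier_mat n n. \<exists>Y'\<in>carrier_mat q n. psd X' \<and>
    psd (- lmi_matrix A B1 B2 C D1 D2 (g + e) X' Y')"
proof -
  \<comment> \<open>Half of the slack pays for strict feasibility, the other half for the coupling
    of \<open>w\<close> with the deflated states through \<open>B11\<close>.\<close>
  have "0 < e / 2" using e by simp
  from lmi_strictly_feasible[OF A22 B12 B22 C2 D1 D2 X Y F _ this, of g]
  obtain X2 Y2 d where X2: "X2 \<in> carrier_mat k k" "psd X2" and Y2: "Y2 \<in> carrier_mat q k" and d: "0 < d"
    and strict: "\<And>x z w. x \<in> carrier_vec k \<Longrightarrow> z \<in> carrier_vec p \<Longrightarrow> w \<in> carrier_vec m \<Longrightarrow>
      lmi_form A22 B12 B22 C2 D1 D2 X2 Y2 x z w \<le> (g + e / 2) * (z \<bullet> z + w \<bullet> w) - d * (x \<bullet> x)"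
    using feas[unfolded psd_lmi_matrix_iff_form[OF A22 B12 B22 C2 D1 D2 X(1) Y]] by blast
  define G where "G = A12 * X2 + B21 * Y2"
  have G: "G \<in> carrier_mat r k" using A12 X2 B21 Y2 by (simp add: G_def)
  obtain c1 where c1: "0 \<le> c1" and young1: "\<And>a b. a \<in> carrier_vec r \<Longrightarrow> b \<in> carrier_vec k \<Longrightarrow>
      2 * (a \<bullet> (G *\<^sub>v b)) \<le> c1 * (a \<bullet> a) + d * (b \<bullet> b)"
    using mat_form_young[OF G d] by blast
  obtain c2 where c2: "0 \<le> c2" and young2: "\<And>a w. a \<in> carrier_vec r \<Longrightarrow> w \<in> carrier_vec m \<Longrightarrow>
      2 * (a \<bullet> (B11 *\<^sub>v w)) \<le> c2 * (a \<bullet> a) + e / 2 * (w \<bullet> w)"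
    using mat_form_young[OF B11 \<open>0 < e / 2\<close>] by blast
  obtain \<mu> where \<mu>: "0 < \<mu>"
    and decay: "\<And>a. a \<in> carrier_vec r \<Longrightarrow> a \<bullet> (mat_diag r lam *\<^sub>v a) \<le> - \<mu> * (a \<bullet> a)"
    using mat_diag_form_le[of r lam, OF lam] by blast
  \<comment> \<open>Chosen so that the decay \<open>2 * t * \<mu>\<close> along
    \<open>a = H\<^sup>T *\<^sub>v x\<close> pays exactly for the two Young constants, that of
    \<open>G\<close> and that of \<open>B11\<close>.\<close>
  define t where "t = (c1 + c2) / (2 * \<mu>)"
  have t: "0 \<le> t" "2 * t * \<mu> = c1 + c2" using c1 c2 \<mu> by (simp_all add: t_def)
  \<comment> \<open>\<open>X'\<close> is the congruence by \<open>T\<close> of the block diagonal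
    matrix with blocks \<open>t\<close> times the identity and \<open>X2\<close>; \<open>Y'\<close>
    is \<open>(t R, Y2)\<close> times the transpose of \<open>T\<close>.\<close>
  define X' where "X' = t \<cdot>\<^sub>m (H * H\<^sup>T) + J * X2 * J\<^sup>T"
  define Y' where "Y' = t \<cdot>\<^sub>m (R * H\<^sup>T) + Y2 * J\<^sup>T"
  have HT: "H\<^sup>T \<in> carrier_mat r n" and JT: "J\<^sup>T \<in> carrier_mat k n" using H J by simp_all
  note HH = mult_carrier_mat[OF H HT] and RH = mult_carrier_mat[OF R HT]
    and JX = mult_carrier_mat[OF J X2(1)] and YJ = mult_carrier_mat[OF Y2 JT]
  note JXJ = mult_carrier_mat[OF JX JT]
  have X': "X' \<in> carrier_mat n n" and Y': "Y' \<in> carrier_mat q n"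
    using HH RH JXJ YJ by (simp_all add: X'_def Y'_def)
  have "psd (H * H\<^sup>T)"
    using psd_congruence[OF one_carrier_mat H psd_one] H by simp
  then have psd': "psd X'"
    unfolding X'_def
    by (intro psd_add[OF smult_carrier_mat[OF HH] JXJ] psd_smult[OF HH] psd_congruence[OF X2(1) J X2(2)] t)
  have "lmi_form A B1 B2 C D1 D2 X' Y' x z w \<le> (g + e) * (z \<bullet> z + w \<bullet> w)"
    if x: "x \<in> carrier_vec n" and z: "z \<in> carrier_vec p" and w: "w \<in> carrier_vec m" for x z w
  proof -
    define a where "a = H\<^sup>T *\<^sub>v x"
    define b where "b = J\<^sup>T *\<^sub>v x"
    define c where "c = X2 *\<^sub>v b"
    define f where "f = Y2 *\<^sub>v b"
    have a: "a \<in> carrier_vec r" and b: "b \<in> carrier_vec k" and c: "c \<in> carrier_vec k" and f: "f \<in> carrier_vec q"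
      using HT JT x X2 Y2 by (simp_all add: a_def b_def c_def f_def)
    have Ha: "H *\<^sub>v a \<in> carrier_vec n" and Ra: "R *\<^sub>v a \<in> carrier_vec q" and Jc: "J *\<^sub>v c \<in> carrier_vec n"
      using H R J a c by simp_all
    have HHx: "(H * H\<^sup>T) *\<^sub>v x = H *\<^sub>v a" and RHx: "(R * H\<^sup>T) *\<^sub>v x = R *\<^sub>v a"
      and YJx: "(Y2 * J\<^sup>T) *\<^sub>v x = f"
      by (simp_all only: a_def b_def f_def assoc_mult_mat_vec[OF H HT x] assoc_mult_mat_vec[OF R HT x]
          assoc_mult_mat_vec[OF Y2 JT x])
    have JXJx: "(J * X2 * J\<^sup>T) *\<^sub>v x = J *\<^sub>v c"
      by (simp only: assoc_mult_mat_vec[OF JX JT x] b_def[symmetric] assoc_mult_mat_vec[OF J X2(1) b] c_def)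
    have X'x: "X' *\<^sub>v x = t \<cdot>\<^sub>v (H *\<^sub>v a) + J *\<^sub>v c"
      by (simp only: X'_def add_mult_distrib_mat_vec[OF smult_carrier_mat[OF HH] JXJ x]
          smult_mat_mult_vec[OF HH x] HHx JXJx)
    have Y'x: "Y' *\<^sub>v x = t \<cdot>\<^sub>v (R *\<^sub>v a) + f"
      by (simp only: Y'_def add_mult_distrib_mat_vec[OF smult_carrier_mat[OF RH] YJ x]
          smult_mat_mult_vec[OF RH x] RHx YJx)
    have lin: "v \<bullet> (M *\<^sub>v (t \<cdot>\<^sub>v y + y')) = t * (v \<bullet> (M *\<^sub>v y)) + v \<bullet> (M *\<^sub>v y')"
      if "M \<in> carrier_mat i j" "v \<in> carrier_vec i" "y \<in> carrier_vec j" "y' \<in> carrier_vec j" for M i j v y y'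
      using that by (simp add: mult_add_distrib_mat_vec[of _ i j] mult_mat_vec[of _ i j] scalar_prod_add_distrib[of _ i])
    have moveH: "x \<bullet> (H *\<^sub>v v) = a \<bullet> v" if "v \<in> carrier_vec r" for v
      unfolding a_def using transpose_vec_mult_scalar[OF H that x] by simp
    have moveJ: "x \<bullet> (J *\<^sub>v v) = b \<bullet> v" if "v \<in> carrier_vec k" for v
      unfolding b_def using transpose_vec_mult_scalar[OF J that x] by simp
    have split: "x \<bullet> ((H * M1 + J * M2) *\<^sub>v v) = a \<bullet> (M1 *\<^sub>v v) + b \<bullet> (M2 *\<^sub>v v)"
      if M1: "M1 \<in> carrier_mat r l" and M2: "M2 \<in> carrier_mat k l" and v: "v \<in> carrier_vec l" for M1 M2 l v
    proof -
      have "(H * M1 + J * M2) *\<^sub>v v = H *\<^sub>v (M1 *\<^sub>v v) + J *\<^sub>v (M2 *\<^sub>v v)"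
        by (simp only: add_mult_distrib_mat_vec[OF mult_carrier_mat[OF H M1] mult_carrier_mat[OF J M2] v]
            assoc_mult_mat_vec[OF H M1 v] assoc_mult_mat_vec[OF J M2 v])
      then show ?thesis
        using H J M1 M2 v x by (simp add: scalar_prod_add_distrib[of _ n] moveH moveJ)
    qed
    have sum_form: "v \<bullet> (M1 *\<^sub>v (N1 *\<^sub>v a)) + v \<bullet> (M2 *\<^sub>v (N2 *\<^sub>v a)) = v \<bullet> ((M1 * N1 + M2 * N2) *\<^sub>v a)"
      if M1: "M1 \<in> carrier_mat l i" and N1: "N1 \<in> carrier_mat i r" and M2: "M2 \<in> carrier_mat l j"
        and N2: "N2 \<in> carrier_mat j r" and v: "v \<in> carrier_vec l" for M1 N1 M2 N2 l i j v
    proof -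
      have "(M1 * N1 + M2 * N2) *\<^sub>v a = M1 *\<^sub>v (N1 *\<^sub>v a) + M2 *\<^sub>v (N2 *\<^sub>v a)"
        by (simp only: add_mult_distrib_mat_vec[OF mult_carrier_mat[OF M1 N1] mult_carrier_mat[OF M2 N2] a]
            assoc_mult_mat_vec[OF M1 N1 a] assoc_mult_mat_vec[OF M2 N2 a])
      then show ?thesis using M1 N1 M2 N2 a v by (simp add: scalar_prod_add_distrib[of _ l])
    qed
    have "x \<bullet> (A *\<^sub>v (H *\<^sub>v a)) + x \<bullet> (B2 *\<^sub>v (R *\<^sub>v a)) = x \<bullet> ((H * mat_diag r lam) *\<^sub>v a)"
      unfolding sum_form[OF A H B2 R x] AH ..
    also have "\<dots> = a \<bullet> (mat_diag r lam *\<^sub>v a)"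
      using a by (simp only: assoc_mult_mat_vec[OF H mat_diag_dim a] moveH mult_mat_vec_carrier[OF mat_diag_dim a])
    finally have 1: "x \<bullet> (A *\<^sub>v (H *\<^sub>v a)) + x \<bullet> (B2 *\<^sub>v (R *\<^sub>v a)) = a \<bullet> (mat_diag r lam *\<^sub>v a)" .
    \<comment> \<open>The output part of the null vector equations: \<open>t\<close> drops out of
      the output row, so its size has no influence on the level.\<close>
    have 2: "z \<bullet> (C *\<^sub>v (H *\<^sub>v a)) + z \<bullet> (D2 *\<^sub>v (R *\<^sub>v a)) = 0"
    proof -
      have "0\<^sub>m p r *\<^sub>v a = 0\<^sub>v p" by (rule eq_vecI) (use a in simp_all)
      then show ?thesis unfolding sum_form[OF C H D2 R z] CH using z by simp
    qed
    have 3: "x \<bullet> (A *\<^sub>v (J *\<^sub>v c)) = a \<bullet> (A12 *\<^sub>v c) + b \<bullet> (A22 *\<^sub>v c)"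
      using split[OF A12 A22 c] by (simp only: AJ[symmetric] assoc_mult_mat_vec[OF A J c])
    have 4: "x \<bullet> (B2 *\<^sub>v f) = a \<bullet> (B21 *\<^sub>v f) + b \<bullet> (B22 *\<^sub>v f)"
      unfolding B2_split by (rule split[OF B21 B22 f])
    have 5: "x \<bullet> (B1 *\<^sub>v w) = a \<bullet> (B11 *\<^sub>v w) + b \<bullet> (B12 *\<^sub>v w)"
      unfolding B1_split by (rule split[OF B11 B12 w])
    have 6: "C *\<^sub>v (J *\<^sub>v c) = C2 *\<^sub>v c"
      by (simp only: CJ[symmetric] assoc_mult_mat_vec[OF C J c])
    have G_eq: "a \<bullet> (G *\<^sub>v b) = a \<bullet> (A12 *\<^sub>v c) + a \<bullet> (B21 *\<^sub>v f)"
    proof -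
      have "G *\<^sub>v b = A12 *\<^sub>v c + B21 *\<^sub>v f"
        by (simp only: G_def c_def f_def assoc_mult_mat_vec[OF A12 X2(1) b] assoc_mult_mat_vec[OF B21 Y2 b]
            add_mult_distrib_mat_vec[OF mult_carrier_mat[OF A12 X2(1)] mult_carrier_mat[OF B21 Y2] b])
      then show ?thesis using a A12 B21 c f by (simp add: scalar_prod_add_distrib[of _ r])
    qed
    have sub: "lmi_form A22 B12 B22 C2 D1 D2 X2 Y2 b z w =
        2 * (b \<bullet> (A22 *\<^sub>v c) + b \<bullet> (B22 *\<^sub>v f)) + 2 * (z \<bullet> (C2 *\<^sub>v c) + z \<bullet> (D2 *\<^sub>v f)) +
        2 * (b \<bullet> (B12 *\<^sub>v w)) + 2 * (z \<bullet> (D1 *\<^sub>v w))"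
      by (simp only: lmi_form_def c_def f_def)
    have full: "lmi_form A B1 B2 C D1 D2 X' Y' x z w =
        2 * (t * (x \<bullet> (A *\<^sub>v (H *\<^sub>v a)) + x \<bullet> (B2 *\<^sub>v (R *\<^sub>v a))) + (x \<bullet> (A *\<^sub>v (J *\<^sub>v c)) + x \<bullet> (B2 *\<^sub>v f))) +
        2 * (t * (z \<bullet> (C *\<^sub>v (H *\<^sub>v a)) + z \<bullet> (D2 *\<^sub>v (R *\<^sub>v a))) + (z \<bullet> (C *\<^sub>v (J *\<^sub>v c)) + z \<bullet> (D2 *\<^sub>v f))) +
        2 * (x \<bullet> (B1 *\<^sub>v w)) + 2 * (z \<bullet> (D1 *\<^sub>v w))"
      by (simp only: lmi_form_def X'x Y'x lin[OF A x Ha Jc] lin[OF B2 x Ra f] lin[OF C z Ha Jc]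
          lin[OF D2 z Ra f]) (simp add: ring_distribs)
    have form: "lmi_form A B1 B2 C D1 D2 X' Y' x z w =
        2 * t * (a \<bullet> (mat_diag r lam *\<^sub>v a)) + 2 * (a \<bullet> (G *\<^sub>v b)) + 2 * (a \<bullet> (B11 *\<^sub>v w)) +
        lmi_form A22 B12 B22 C2 D1 D2 X2 Y2 b z w"
      by (simp only: full sub 1 2 3 4 5 6 G_eq) simp
    have "2 * t * (a \<bullet> (mat_diag r lam *\<^sub>v a)) \<le> 2 * t * (- \<mu> * (a \<bullet> a))"
      using decay[OF a] t by (intro mult_left_mono) simp_all
    also have "\<dots> = - (2 * t * \<mu>) * (a \<bullet> a)" by simp
    also have "\<dots> = - (c1 * (a \<bullet> a)) - c2 * (a \<bullet> a)" unfolding t(2) by (simp add: ring_distribs)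
    finally have "2 * t * (a \<bullet> (mat_diag r lam *\<^sub>v a)) \<le> - (c1 * (a \<bullet> a)) - c2 * (a \<bullet> a)" .
    then have "lmi_form A B1 B2 C D1 D2 X' Y' x z w \<le> e / 2 * (w \<bullet> w) + (g + e / 2) * (z \<bullet> z + w \<bullet> w)"
      using young1[OF a b] young2[OF a w] strict[OF b z w] unfolding form by linarith
    also have "\<dots> \<le> (g + e) * (z \<bullet> z + w \<bullet> w)"
    proof -
      have "0 \<le> e / 2 * (z \<bullet> z)" using e scalar_prod_self_nonneg[of z] by simp
      then show ?thesis by (simp add: ring_distribs)
    qed
    finally show ?thesis .
  qed
  then have "psd (- lmi_matrix A B1 B2 C D1 D2 (g + e) X' Y')"
    unfolding psd_lmi_matrix_iff_form[OF A B1 B2 C D1 D2 X' Y'] by blast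
  then show ?thesis using X' Y' psd' by blast
qed

text \<open>Restriction keeps the level, so one inequality is an inclusion of feasible levels.
  Extension loses an arbitrarily small \<open>e\<close>, which an infimum does not notice. Neither
  infimum has to be attained.\<close>

lemma lmi_optimal_value_eq:
  assumes F: "F \<in> carrier_mat q k" "hurwitz (A22 + B22 * F)"
  shows "lmi_optimal_value A B1 B2 C D1 D2 = lmi_optimal_value A22 B12 B22 C2 D1 D2"
proof (rule antisym)
  have dims: "dim_row A = n" "dim_col B2 = q" "dim_row A22 = k" "dim_col B22 = q"
    using A B2 A22 B22 by simp_all
  show "lmi_optimal_value A22 B12 B22 C2 D1 D2 \<le> lmi_optimal_value A B1 B2 C D1 D2"
    unfolding lmi_optimal_value_def dims
    by (rule Inf_superset_mono) (use lmi_restrict in blast)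
  have "lmi_optimal_value A B1 B2 C D1 D2 \<le> ereal g"
    if X: "X \<in> carrier_mat k k" "psd X" and Y: "Y \<in> carrier_mat q k"
      and feas: "psd (- lmi_matrix A22 B12 B22 C2 D1 D2 g X Y)" for g X Y
  proof (rule ereal_le_epsilon2)
    fix e :: real assume "0 < e"
    then obtain X' Y' where "X' \<in> carrier_mat n n" "Y' \<in> carrier_mat q n" "psd X'"
      "psd (- lmi_matrix A B1 B2 C D1 D2 (g + e) X' Y')"
      using lmi_extend[OF X Y F feas] by blast
    then have "lmi_optimal_value A B1 B2 C D1 D2 \<le> ereal (g + e)"
      unfolding lmi_optimal_value_def dims by (intro Inf_lower CollectI exI[of _ "g + e"] exI[of _ X'] exI[of _ Y']) simp
    then show "lmi_optimal_value A B1 B2 C D1 D2 \<le> ereal g + ereal e" by simp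
  qed
  then show "lmi_optimal_value A B1 B2 C D1 D2 \<le> lmi_optimal_value A22 B12 B22 C2 D1 D2"
    unfolding lmi_optimal_value_def[of A22] dims by (intro Inf_greatest) blast
qed

end

section \<open>The closed loop\<close>

lemma mat_inv_props:
  assumes M: "M \<in> carrier_mat n n" and det: "det M \<noteq> 0"
  shows "mat_inv M \<in> carrier_mat n n" "M * mat_inv M = 1\<^sub>m n" "mat_inv M * M = 1\<^sub>m n"
proof -
  obtain N where "mat_inverse M = Some N"
    using mat_inverse(1)[OF M, where b = "()"] det_non_zero_imp_unit[OF M det, where b = "()"]
    by (cases "mat_inverse M") auto
  then show "mat_inv M \<in> carrier_mat n n" "M * mat_inv M = 1\<^sub>m n" "mat_inv M * M = 1\<^sub>m n"
    using mat_inverse(2)[OF M] by (auto simp: mat_inv_def)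
qed

lemma invertible_mat_det:
  fixes M :: "'a::field mat"
  assumes "M \<in> carrier_mat n n" "invertible_mat M"
  shows "det M \<noteq> 0"
proof -
  obtain N where MN: "M * N = 1\<^sub>m n" and NM: "N * M = 1\<^sub>m (dim_row N)"
    using assms by (auto simp: invertible_mat_def inverts_mat_def)
  \<comment> \<open>\<open>inverts_mat\<close> does not prescribe the size of \<open>N\<close>;
    counting the columns of the two identities does.\<close>
  have "dim_col (M * N) = n" "dim_col (N * M) = dim_row N" by (simp_all only: MN NM index_one_mat)
  then have "N \<in> carrier_mat n n" using assms(1) by auto
  from det_mult[OF assms(1) this] show ?thesis by (auto simp: MN)
qed

text \<open>A kernel vector would be an eigenvector of \<open>M + N\<close> for the imaginary number
  \<open>s\<close>. This makes \<open>mat_inv\<close> in the transfer function a genuine inverse;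
  \<open>M\<close> and \<open>N\<close> are kept apart to match the shape of
  \<open>closed_loop_tf\<close>.\<close>

lemma hurwitz_resolvent_det:
  assumes M: "M \<in> carrier_mat n n" and N: "N \<in> carrier_mat n n"
    and hurw: "hurwitz (M + N)" and s: "Re s = 0"
  shows "det (s \<cdot>\<^sub>m 1\<^sub>m n - cmat M - cmat N) \<noteq> 0"
proof
  let ?S = "s \<cdot>\<^sub>m 1\<^sub>m n - cmat M - cmat N"
  have S: "?S \<in> carrier_mat n n" using M N by auto
  assume "det ?S = 0"
  then obtain v where v: "v \<in> carrier_vec n" "v \<noteq> 0\<^sub>v n" and 0: "?S *\<^sub>v v = 0\<^sub>v n"
    unfolding det_0_iff_vec_prod_zero_field[OF S] by blast
  have MN: "cmat (M + N) = cmat M + cmat N"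
    by (rule eq_matI) (use M N in simp_all)
  have "?S *\<^sub>v v = s \<cdot>\<^sub>v v - cmat M *\<^sub>v v - cmat N *\<^sub>v v"
  proof -
    have "?S *\<^sub>v v = (s \<cdot>\<^sub>m 1\<^sub>m n - cmat M) *\<^sub>v v - cmat N *\<^sub>v v"
      by (rule minus_mult_distrib_mat_vec[of _ n n]) (use M N v in auto)
    also have "(s \<cdot>\<^sub>m 1\<^sub>m n - cmat M) *\<^sub>v v = (s \<cdot>\<^sub>m 1\<^sub>m n) *\<^sub>v v - cmat M *\<^sub>v v"
      by (rule minus_mult_distrib_mat_vec[of _ n n]) (use M v in auto)
    finally show ?thesis using v by (simp add: smult_one_mult_vec)
  qed
  moreover have "cmat (M + N) *\<^sub>v v = cmat M *\<^sub>v v + cmat N *\<^sub>v v"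
    unfolding MN by (rule add_mult_distrib_mat_vec[of _ n n]) (use M N v in auto)
  ultimately have "cmat (M + N) *\<^sub>v v = s \<cdot>\<^sub>v v"
  proof (intro eq_vecI)
    fix i assume i: "i < dim_vec (s \<cdot>\<^sub>v v)"
    assume 1: "?S *\<^sub>v v = s \<cdot>\<^sub>v v - cmat M *\<^sub>v v - cmat N *\<^sub>v v"
      and 2: "cmat (M + N) *\<^sub>v v = cmat M *\<^sub>v v + cmat N *\<^sub>v v"
    from i v have i: "i < n" by simp
    have d: "dim_vec (cmat M *\<^sub>v v) = n" "dim_vec (cmat N *\<^sub>v v) = n" using M N by simp_all
    have "(s \<cdot>\<^sub>v v - cmat M *\<^sub>v v - cmat N *\<^sub>v v) $ i = 0" unfolding 1[symmetric] 0 using i by simp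
    then have "(s \<cdot>\<^sub>v v) $ i - (cmat M *\<^sub>v v) $ i - (cmat N *\<^sub>v v) $ i = 0"
      using i d by (simp del: index_mult_mat_vec)
    moreover have "(cmat (M + N) *\<^sub>v v) $ i = (cmat M *\<^sub>v v) $ i + (cmat N *\<^sub>v v) $ i"
      unfolding 2 using i d by (simp del: index_mult_mat_vec)
    ultimately show "(cmat (M + N) *\<^sub>v v) $ i = (s \<cdot>\<^sub>v v) $ i" by (simp add: diff_diff_eq)
  qed (use M N v in simp)
  then have "eigenvalue (cmat (M + N)) s"
    using N v by (auto simp: eigenvalue_def eigenvector_def)
  then show False using hurw s by (auto simp: hurwitz_def)
qed

section \<open>The closed loop modulo the range of \<open>H\<close>\<close>

context zero_deflation
begin

context
  fixes F K :: "real mat"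
  assumes F: "F \<in> carrier_mat q k" and K_eq: "K = R * P + F * E"
begin

lemma gain_carrier: "K \<in> carrier_mat q n"
  using R P F E by (simp add: K_eq)

lemma closed_loop_carrier:
  "A + B2 * K \<in> carrier_mat n n" "A22 + B22 * F \<in> carrier_mat k k"
  "C + D2 * K \<in> carrier_mat p n" "C2 + D2 * F \<in> carrier_mat p k"
  using A B2 gain_carrier A22 B22 F C D2 C2 by simp_all

text \<open>The summand \<open>R * P\<close> of the gain is used up by \<open>E_A\<close>; the
  summand \<open>F * E\<close> is the feedback \<open>F\<close> acting on the quotient.\<close>

lemma closed_loop_quotient: "E * (A + B2 * K) = (A22 + B22 * F) * E"
proof -
  note RP = mult_carrier_mat[OF R P] and FE = mult_carrier_mat[OF F E]
  have "E * (A + B2 * K) = E * A + B22 * K"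
    by (simp only: mult_add_distrib_mat[OF E A mult_carrier_mat[OF B2 gain_carrier]]
        assoc_mult_mat[OF E B2 gain_carrier, symmetric] E_B2)
  also have "\<dots> = E * A + (B22 * (R * P) + (B22 * F) * E)"
    by (simp only: K_eq mult_add_distrib_mat[OF B22 RP FE] assoc_mult_mat[OF B22 F E])
  also have "\<dots> = (E * A + B22 * (R * P)) + (B22 * F) * E"
    using assoc_add_mat[OF mult_carrier_mat[OF E A] mult_carrier_mat[OF B22 RP]
        mult_carrier_mat[OF mult_carrier_mat[OF B22 F] E]] by simp
  also have "\<dots> = (A22 + B22 * F) * E"
    by (simp only: E_A add_mult_distrib_mat[OF A22 mult_carrier_mat[OF B22 F] E])
  finally show ?thesis .
qed

lemma closed_loop_output: "C + D2 * K = (C2 + D2 * F) * E"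
proof -
  note RP = mult_carrier_mat[OF R P] and FE = mult_carrier_mat[OF F E]
  have "C + D2 * K = C + (D2 * (R * P) + (D2 * F) * E)"
    by (simp only: K_eq mult_add_distrib_mat[OF D2 RP FE] assoc_mult_mat[OF D2 F E])
  also have "\<dots> = (C + D2 * (R * P)) + (D2 * F) * E"
    using assoc_add_mat[OF C mult_carrier_mat[OF D2 RP]
        mult_carrier_mat[OF mult_carrier_mat[OF D2 F] E]] by simp
  also have "\<dots> = (C2 + D2 * F) * E"
    by (simp only: C_eq add_mult_distrib_mat[OF C2 mult_carrier_mat[OF D2 F] E])
  finally show ?thesis .
qed

lemma closed_loop_H: "(A + B2 * K) * H = H * mat_diag r lam"
proof -
  have "K * H = R * (P * H) + F * (E * H)"
    by (simp only: K_eq add_mult_distrib_mat[OF mult_carrier_mat[OF R P] mult_carrier_mat[OF F E] H]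
        assoc_mult_mat[OF R P H] assoc_mult_mat[OF F E H])
  also have "\<dots> = R" using R F by (simp add: PH EH)
  finally have "K * H = R" .
  then show ?thesis
    by (simp only: add_mult_distrib_mat[OF A mult_carrier_mat[OF B2 gain_carrier] H] assoc_mult_mat[OF B2 gain_carrier H] AH)
qed

text \<open>The spectrum splits along the invariant subspace. An eigenvector not killed by
  \<open>E\<close> projects to an eigenvector of the subsystem's closed loop; one killed by
  \<open>E\<close> lies in the range of \<open>H\<close>, where the closed loop acts as
  \<open>mat_diag r lam\<close>.\<close>

lemma hurwitz_closed_loop:
  assumes hurw: "hurwitz (A22 + B22 * F)"
  shows "hurwitz (A + B2 * K)"
  unfolding hurwitz_def
proof (intro allI impI)
  fix l assume "eigenvalue (cmat (A + B2 * K)) l"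
  then obtain v where v: "v \<in> carrier_vec n" "v \<noteq> 0\<^sub>v n" and ev: "cmat (A + B2 * K) *\<^sub>v v = l \<cdot>\<^sub>v v"
    using closed_loop_carrier by (auto simp: eigenvalue_def eigenvector_def)
  let ?M = "cmat (A + B2 * K)" and ?N = "cmat (A22 + B22 * F)"
  have M: "?M \<in> carrier_mat n n" and N: "?N \<in> carrier_mat k k"
    and cE: "cmat E \<in> carrier_mat k n" and cH: "cmat H \<in> carrier_mat n r"
    and cP: "cmat P \<in> carrier_mat r n" and cJ: "cmat J \<in> carrier_mat n k"
    using closed_loop_carrier E H P J by simp_all
  define b where "b = cmat E *\<^sub>v v"
  have b: "b \<in> carrier_vec k" using cE v by (simp add: b_def)
  have "cmat E * ?M = ?N * cmat E"
    by (simp only: of_real_hom.mat_hom_mult[OF E closed_loop_carrier(1), symmetric]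
        of_real_hom.mat_hom_mult[OF closed_loop_carrier(2) E, symmetric] closed_loop_quotient)
  then have "?N *\<^sub>v b = cmat E *\<^sub>v (?M *\<^sub>v v)"
    unfolding b_def by (simp only: assoc_mult_mat_vec[OF N cE v(1), symmetric] assoc_mult_mat_vec[OF cE M v(1), symmetric])
  then have Nb: "?N *\<^sub>v b = l \<cdot>\<^sub>v b"
    unfolding ev b_def by (simp only: mult_mat_vec[OF cE v(1)])
  show "Re l < 0"
  proof (cases "b = 0\<^sub>v k")
    case False
    then have "eigenvalue ?N l" using Nb b B22 by (auto simp: eigenvalue_def eigenvector_def)
    then show ?thesis using hurw by (simp add: hurwitz_def)
  next
    case True
    \<comment> \<open>The coordinates of \<open>v\<close> with respect to the columns of
      \<open>H\<close>; any nonzero coordinate identifies \<open>l\<close> with the corresponding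
      \<open>lam i\<close>.\<close>
    define a where "a = cmat P *\<^sub>v v"
    have a: "a \<in> carrier_vec r" using cP v by (simp add: a_def)
    note HP = mult_carrier_mat[OF cH cP] and JE = mult_carrier_mat[OF cJ cE]
    have "cmat H * cmat P + cmat J * cmat E = cmat (H * P + J * E)"
      by (rule eq_matI) (use H P J E in \<open>simp_all add: of_real_hom.mat_hom_mult[symmetric, of _ n r _ n] of_real_hom.mat_hom_mult[symmetric, of _ n k _ n]\<close>)
    then have "cmat H * cmat P + cmat J * cmat E = 1\<^sub>m n"
      by (simp add: HP_JE of_real_hom.mat_hom_one)
    then have "v = (cmat H * cmat P + cmat J * cmat E) *\<^sub>v v" using v by simp
    also have "\<dots> = cmat H *\<^sub>v a + cmat J *\<^sub>v b"
      by (simp only: add_mult_distrib_mat_vec[OF HP JE v(1)] assoc_mult_mat_vec[OF cH cP v(1)]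
          assoc_mult_mat_vec[OF cJ cE v(1)] a_def b_def)
    also have "\<dots> = cmat H *\<^sub>v a"
    proof -
      have "cmat J *\<^sub>v 0\<^sub>v k = 0\<^sub>v n" by (rule eq_vecI) (use J in simp_all)
      then show ?thesis using cH a by (simp add: True)
    qed
    finally have vHa: "v = cmat H *\<^sub>v a" .
    have "cmat (mat_diag r lam) = mat_diag r (\<lambda>i. complex_of_real (lam i))"
      by (rule eq_matI) (simp_all add: mat_diag_def)
    then have MH: "?M * cmat H = cmat H * mat_diag r (\<lambda>i. complex_of_real (lam i))"
      by (simp only: of_real_hom.mat_hom_mult[OF closed_loop_carrier(1) H, symmetric] closed_loop_H
          of_real_hom.mat_hom_mult[OF H mat_diag_dim])
    have PHc: "cmat P * cmat H = 1\<^sub>m r"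
      by (simp only: of_real_hom.mat_hom_mult[OF P H, symmetric] PH of_real_hom.mat_hom_one)
    define g where "g = mat_diag r (\<lambda>i. complex_of_real (lam i)) *\<^sub>v a"
    have g: "g \<in> carrier_vec r" unfolding g_def by (rule mult_mat_vec_carrier[OF mat_diag_dim a])
    have Mv: "?M *\<^sub>v v = cmat H *\<^sub>v g"
      unfolding vHa g_def
      by (simp only: assoc_mult_mat_vec[OF M cH a, symmetric] MH assoc_mult_mat_vec[OF cH mat_diag_dim a])
    have "g = (cmat P * cmat H) *\<^sub>v g" using g by (simp add: PHc)
    also have "\<dots> = cmat P *\<^sub>v (?M *\<^sub>v v)" unfolding Mv by (rule assoc_mult_mat_vec[OF cP cH g])
    also have "\<dots> = l \<cdot>\<^sub>v a" unfolding ev a_def by (rule mult_mat_vec[OF cP v(1)])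
    finally have ga: "g = l \<cdot>\<^sub>v a" .
    have "a \<noteq> 0\<^sub>v r"
    proof
      assume "a = 0\<^sub>v r"
      moreover have "cmat H *\<^sub>v 0\<^sub>v r = 0\<^sub>v n" by (rule eq_vecI) (use H in simp_all)
      ultimately show False using vHa v by simp
    qed
    then obtain i where i: "i < r" "a $ i \<noteq> 0"
      using a by (metis carrier_vecD eq_vecI index_zero_vec)
    have "complex_of_real (lam i) * a $ i = l * a $ i"
      using arg_cong[OF ga, of "\<lambda>x. x $ i"] i a by (simp add: g_def mat_diag_mult_vec)
    then show ?thesis using i lam by auto
  qed
qed

text \<open>The resolvent matrices satisfy \<open>cmat E * M = N * cmat E\<close>, and this relation
  passes to their inverses. The output matrix supplies the factor \<open>E\<close> by
  \<open>closed_loop_output\<close>; once moved through the inverse, it turns \<open>B1\<close> into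
  \<open>B12\<close>.\<close>

lemma closed_loop_tf_eq:
  assumes hurw: "hurwitz (A22 + B22 * F)" and s: "Re s = 0"
  shows "closed_loop_tf A B1 B2 C D1 D2 K s = closed_loop_tf A22 B12 B22 C2 D1 D2 F s"
proof -
  define M where "M = s \<cdot>\<^sub>m 1\<^sub>m n - cmat A - cmat (B2 * K)"
  define N where "N = s \<cdot>\<^sub>m 1\<^sub>m k - cmat A22 - cmat (B22 * F)"
  note BK = mult_carrier_mat[OF B2 gain_carrier] and BF = mult_carrier_mat[OF B22 F]
  have detM: "det M \<noteq> 0"
    unfolding M_def by (rule hurwitz_resolvent_det[OF A BK hurwitz_closed_loop[OF hurw] s])
  have detN: "det N \<noteq> 0" unfolding N_def by (rule hurwitz_resolvent_det[OF A22 BF hurw s])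
  have M: "M \<in> carrier_mat n n" and N: "N \<in> carrier_mat k k"
    unfolding M_def N_def using BK BF by (auto intro!: minus_carrier_mat simp del: mult_carrier_mat)
  note iM = mat_inv_props[OF M detM] and iN = mat_inv_props[OF N detN]
  have cE: "cmat E \<in> carrier_mat k n" and cB1: "cmat B1 \<in> carrier_mat n m"
    and cC: "cmat (C2 + D2 * F) \<in> carrier_mat p k" and cA: "cmat A \<in> carrier_mat n n"
    and cBK: "cmat (B2 * K) \<in> carrier_mat n n" and cA22: "cmat A22 \<in> carrier_mat k k"
    and cBF: "cmat (B22 * F) \<in> carrier_mat k k"
    using E B1 closed_loop_carrier A BK A22 BF by auto
  have EM: "cmat E * M = N * cmat E"
  proof -
    have sn: "s \<cdot>\<^sub>m 1\<^sub>m n \<in> carrier_mat n n" and sk: "s \<cdot>\<^sub>m 1\<^sub>m k \<in> carrier_mat k k" by simp_all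
    have EBK: "E * (B2 * K) \<in> carrier_mat k n" and EA: "E * A \<in> carrier_mat k n"
      and BFE: "B22 * F * E \<in> carrier_mat k n" and AE: "A22 * E \<in> carrier_mat k n"
      using mult_carrier_mat[OF E BK] mult_carrier_mat[OF E A] mult_carrier_mat[OF BF E]
        mult_carrier_mat[OF A22 E] by simp_all
    have "cmat E * M = cmat E * (s \<cdot>\<^sub>m 1\<^sub>m n) - cmat E * cmat A - cmat E * cmat (B2 * K)"
      unfolding M_def
      by (simp only: mult_minus_distrib_mat[OF cE minus_carrier_mat[OF cA] cBK] mult_minus_distrib_mat[OF cE sn cA])
    also have "\<dots> = s \<cdot>\<^sub>m cmat E - cmat (E * A) - cmat (E * (B2 * K))"
      using cE by (simp add: mult_smult_distrib[OF cE one_carrier_mat] of_real_hom.mat_hom_mult[OF E A]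
          of_real_hom.mat_hom_mult[OF E BK])
    finally have L: "cmat E * M = s \<cdot>\<^sub>m cmat E - cmat (E * A) - cmat (E * (B2 * K))" .
    have "N * cmat E = (s \<cdot>\<^sub>m 1\<^sub>m k) * cmat E - cmat A22 * cmat E - cmat (B22 * F) * cmat E"
      unfolding N_def
      by (simp only: minus_mult_distrib_mat[OF minus_carrier_mat[OF cA22] cBF cE] minus_mult_distrib_mat[OF sk cA22 cE])
    also have "\<dots> = s \<cdot>\<^sub>m cmat E - cmat (A22 * E) - cmat (B22 * F * E)"
      using cE by (simp add: mult_smult_assoc_mat[OF one_carrier_mat cE] of_real_hom.mat_hom_mult[OF A22 E]
          of_real_hom.mat_hom_mult[OF BF E])
    finally have R: "N * cmat E = s \<cdot>\<^sub>m cmat E - cmat (A22 * E) - cmat (B22 * F * E)" .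
    have "E * A + E * (B2 * K) = A22 * E + B22 * F * E"
      using closed_loop_quotient
      by (simp only: mult_add_distrib_mat[OF E A BK] add_mult_distrib_mat[OF A22 BF E])
    then have entry: "(E * A) $$ (i, j) + (E * (B2 * K)) $$ (i, j) = (A22 * E) $$ (i, j) + (B22 * F * E) $$ (i, j)"
      if "i < k" "j < n" for i j
      using that EA EBK AE BFE by (metis carrier_matD index_add_mat(1))
    show ?thesis
      unfolding L R
    proof (rule eq_matI)
      fix i j
      assume "i < dim_row (s \<cdot>\<^sub>m cmat E - cmat (A22 * E) - cmat (B22 * F * E))"
        "j < dim_col (s \<cdot>\<^sub>m cmat E - cmat (A22 * E) - cmat (B22 * F * E))"
      then have ij: "i < k" "j < n" using B22 E by auto
      have c: "complex_of_real ((E * A) $$ (i, j)) + complex_of_real ((E * (B2 * K)) $$ (i, j)) =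
          complex_of_real ((A22 * E) $$ (i, j)) + complex_of_real ((B22 * F * E) $$ (i, j))"
        by (simp only: of_real_add[symmetric] entry[OF ij])
      then show "(s \<cdot>\<^sub>m cmat E - cmat (E * A) - cmat (E * (B2 * K))) $$ (i, j) =
          (s \<cdot>\<^sub>m cmat E - cmat (A22 * E) - cmat (B22 * F * E)) $$ (i, j)"
        using ij EA EBK AE BFE E
        by (simp add: diff_diff_eq del: index_mult_mat)
    qed (use B22 E gain_carrier in auto)
  qed
  have "cmat E * mat_inv M = (mat_inv N * N) * (cmat E * mat_inv M)"
    using cE iM iN by (simp add: left_mult_one_mat[OF mult_carrier_mat[OF cE iM(1)]])
  also have "\<dots> = mat_inv N * ((N * cmat E) * mat_inv M)"
    by (simp only: assoc_mult_mat[OF iN(1) N mult_carrier_mat[OF cE iM(1)]] assoc_mult_mat[OF N cE iM(1)])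
  also have "\<dots> = mat_inv N * (cmat E * (M * mat_inv M))"
    by (simp only: EM[symmetric] assoc_mult_mat[OF cE M iM(1)])
  also have "\<dots> = mat_inv N * cmat E" using cE by (simp add: iM(2))
  finally have inv: "cmat E * mat_inv M = mat_inv N * cmat E" .
  have "cmat (C + D2 * K) * mat_inv M * cmat B1 = cmat (C2 + D2 * F) * (cmat E * mat_inv M) * cmat B1"
    by (simp only: closed_loop_output of_real_hom.mat_hom_mult[OF closed_loop_carrier(4) E]
        assoc_mult_mat[OF cC cE iM(1)])
  also have "\<dots> = cmat (C2 + D2 * F) * mat_inv N * (cmat E * cmat B1)"
    by (simp only: inv assoc_mult_mat[OF cC iN(1) cE, symmetric]
        assoc_mult_mat[OF mult_carrier_mat[OF cC iN(1)] cE cB1])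
  also have "cmat E * cmat B1 = cmat B12"
    by (simp only: of_real_hom.mat_hom_mult[OF E B1, symmetric] E_B1)
  finally show ?thesis
    unfolding closed_loop_tf_def using A A22 by (simp add: M_def N_def)
qed

text \<open>The norm samples a transfer function only at imaginary arguments, exactly where
  \<open>closed_loop_tf_eq\<close> applies.\<close>

lemma performance_index_closed_loop:
  assumes "has_performance_index A22 B12 B22 C2 D1 D2 F g"
  shows "has_performance_index A B1 B2 C D1 D2 K g"
  using assms hurwitz_closed_loop closed_loop_tf_eq
  by (simp add: has_performance_index_def hinf_norm_def)

end

end

section \<open>Obtaining the deflation data from the null vectors and \<open>T\<close>\<close>

theorem mainTheorem5:
  fixes n m1 m2 p1 r :: nat
    and A B1 B2 C1 D11 D12 :: "real mat"
    and lam :: "nat \<Rightarrow> real"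
    and eta xi :: "nat \<Rightarrow> real vec"
    and Hhat Rhat J T :: "real mat"
    and At11 At12 At21 At22 Bt11 Bt12 Bt21 Bt22 Ct11 Ct12 :: "real mat"
    and Kt K :: "real mat"
    and gammat :: real
  assumes A: "A \<in> carrier_mat n n"
    and B1: "B1 \<in> carrier_mat n m1"
    and B2: "B2 \<in> carrier_mat n m2"
    and C1: "C1 \<in> carrier_mat p1 n"
    and D11: "D11 \<in> carrier_mat p1 m1"
    and D12: "D12 \<in> carrier_mat p1 m2"
    and zeros: "\<And>j. j < r \<Longrightarrow> invariant_zero A B2 C1 D12 (complex_of_real (lam j))"
    and nonpos: "\<And>j. j < r \<Longrightarrow> lam j \<le> 0"
    and eta: "\<And>j. j < r \<Longrightarrow> eta j \<in> carrier_vec n"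
    and xi: "\<And>j. j < r \<Longrightarrow> xi j \<in> carrier_vec m2"
    and null: "\<And>j. j < r \<Longrightarrow>
      system_matrix A B2 C1 D12 (lam j) *\<^sub>v (eta j @\<^sub>v xi j) = 0\<^sub>v (n + p1)"
    and indep: "inj_on eta {..<r}"
      "module.lin_indpt class_ring (module_vec TYPE(real) n) (eta ` {..<r})"
    and no_imaginary: "\<And>l. Re l = 0 \<Longrightarrow> \<not> invariant_zero A B2 C1 D12 l"
    and Hhat: "Hhat = mat_of_cols n (map eta [0..<r])"
    and Rhat: "Rhat = mat_of_cols m2 (map xi [0..<r])"
    and J: "J \<in> carrier_mat n (n - r)"
    and T: "T = Hhat @\<^sub>c J" "invertible_mat T"
    and At: "At11 \<in> carrier_mat r r" "At12 \<in> carrier_mat r (n - r)"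
      "At21 \<in> carrier_mat (n - r) r" "At22 \<in> carrier_mat (n - r) (n - r)"
      "mat_inv T * A * T = four_block_mat At11 At12 At21 At22"
    and Bt1: "Bt11 \<in> carrier_mat r m1" "Bt12 \<in> carrier_mat (n - r) m1"
      "mat_inv T * B1 = Bt11 @\<^sub>r Bt12"
    and Bt2: "Bt21 \<in> carrier_mat r m2" "Bt22 \<in> carrier_mat (n - r) m2"
      "mat_inv T * B2 = Bt21 @\<^sub>r Bt22"
    and Ct: "Ct11 \<in> carrier_mat p1 r" "Ct12 \<in> carrier_mat p1 (n - r)"
      "C1 * T = Ct11 @\<^sub>c Ct12"
    and gammat: "lmi_optimal_value At22 Bt12 Bt22 Ct12 D11 D12 = ereal gammat"
    and Kt: "Kt \<in> carrier_mat m2 (n - r)"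
      "has_performance_index At22 Bt12 Bt22 Ct12 D11 D12 Kt gammat"
    and K: "K = (Rhat @\<^sub>c Kt) * mat_inv T"
  shows "K \<in> carrier_mat m2 n \<and>
    has_performance_index A B1 B2 C1 D11 D12 K gammat \<and>
    lmi_optimal_value A B1 B2 C1 D11 D12 = ereal gammat"
proof -
  define S where "S = mat_inv T"
  have H: "Hhat \<in> carrier_mat n r" and R: "Rhat \<in> carrier_mat m2 r"
    by (simp_all add: Hhat Rhat mat_of_cols_def)
  have T_dims: "T \<in> carrier_mat n (r + (n - r))"
    unfolding T(1) by (rule append_cols_carrier[OF H J])
  moreover have "square_mat T" using T(2) by (simp add: invertible_mat_def)
  \<comment> \<open>Subtraction on naturals truncates; squareness of the invertible \<open>T\<close>
    is what yields \<open>r \<le> n\<close>.\<close>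
  ultimately have rn: "r + (n - r) = n" by simp
  have Tc: "T \<in> carrier_mat n n" using T_dims by (simp only: rn)
  from mat_inv_props[OF Tc invertible_mat_det[OF Tc T(2)]]
  have S: "S \<in> carrier_mat n n" and TS: "T * S = 1\<^sub>m n" and ST: "S * T = 1\<^sub>m n"
    by (simp_all only: S_def)
  \<comment> \<open>\<open>P\<close> and \<open>E\<close> are the upper and lower row blocks of the
    inverse of \<open>T\<close>.\<close>
  define P where "P = mat r n (\<lambda>(i, j). S $$ (i, j))"
  define E where "E = mat (n - r) n (\<lambda>(i, j). S $$ (i + r, j))"
  have P: "P \<in> carrier_mat r n" and E: "E \<in> carrier_mat (n - r) n" by (simp_all add: P_def E_def)
  have S_split: "S = P @\<^sub>r E"
    by (rule eq_matI) (use S rn in \<open>auto simp: append_rows_def P_def E_def\<close>)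
  have HP_JE: "Hhat * P + J * E = 1\<^sub>m n"
    using TS unfolding T(1) S_split append_cols_mult_append_rows[OF H J P E] .
  have "four_block_mat (P * Hhat) (P * J) (E * Hhat) (E * J) =
      four_block_mat (1\<^sub>m r) (0\<^sub>m r (n - r)) (0\<^sub>m (n - r) r) (1\<^sub>m (n - r))"
    using ST unfolding T(1) S_split append_rows_mult_append_cols[OF P E H J] four_block_one_mat rn .
  note blocks = four_block_mat_inject[OF mult_carrier_mat[OF P H] mult_carrier_mat[OF P J]
      mult_carrier_mat[OF E H] mult_carrier_mat[OF E J] one_carrier_mat zero_carrier_mat
      zero_carrier_mat one_carrier_mat this]
  \<comment> \<open>Turns the given partitions of \<open>S * M\<close> into expansions of
    \<open>M\<close> along \<open>Hhat\<close> and \<open>J\<close>, the form that the locale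
    expects.\<close>
  have solve: "M = T * N" if "S * M = N" "M \<in> carrier_mat n l" for M N l
    using that S Tc by (simp add: assoc_mult_mat[OF Tc S, symmetric] TS flip: that(1))
  have AT: "A * T \<in> carrier_mat n n" using A Tc by simp
  have "S * (A * T) = four_block_mat At11 At12 At21 At22"
    using At(5) by (simp only: S_def[symmetric] assoc_mult_mat[OF S A Tc])
  from solve[OF this AT]
  have "(A * Hhat) @\<^sub>c (A * J) = (Hhat * At11 + J * At21) @\<^sub>c (Hhat * At12 + J * At22)"
    unfolding T(1) mult_append_cols[OF A H J] append_cols_mult_four_block[OF H J At(1-4)] .
  then have AJ: "A * J = Hhat * At12 + J * At22"
    by (rule append_cols_inject(2)[of _ n r _ "n - r", rotated 4]) (use A H J At in simp_all)
  have B1_split: "B1 = Hhat * Bt11 + J * Bt12"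
    using solve[OF Bt1(3)[folded S_def] B1]
    unfolding T(1) append_cols_mult_append_rows[OF H J Bt1(1,2)] .
  have B2_split: "B2 = Hhat * Bt21 + J * Bt22"
    using solve[OF Bt2(3)[folded S_def] B2]
    unfolding T(1) append_cols_mult_append_rows[OF H J Bt2(1,2)] .
  have CJ: "C1 * J = Ct12"
    using Ct(3) unfolding T(1) mult_append_cols[OF C1 H J]
    by (rule append_cols_inject(2)[OF mult_carrier_mat[OF C1 H] mult_carrier_mat[OF C1 J] Ct(1,2)])
  have null_eq: "(A *\<^sub>v eta j - lam j \<cdot>\<^sub>v eta j) + B2 *\<^sub>v xi j = 0\<^sub>v n"
    "C1 *\<^sub>v eta j + D12 *\<^sub>v xi j = 0\<^sub>v p1" if j: "j < r" for j
  proof -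
    have Al: "A - lam j \<cdot>\<^sub>m 1\<^sub>m n \<in> carrier_mat n n" by (rule minus_carrier_mat) simp
    have "((A - lam j \<cdot>\<^sub>m 1\<^sub>m n) *\<^sub>v eta j + B2 *\<^sub>v xi j) @\<^sub>v (C1 *\<^sub>v eta j + D12 *\<^sub>v xi j) =
        0\<^sub>v n @\<^sub>v 0\<^sub>v p1"
    proof -
      have "0\<^sub>v (n + p1) = (0\<^sub>v n @\<^sub>v 0\<^sub>v p1 :: real vec)" by (rule eq_vecI) auto
      then show ?thesis
        using null[OF j] A four_block_mat_mult_vec[OF Al B2 C1 D12 eta[OF j] xi[OF j]]
        by (simp add: system_matrix_def)
    qed
    moreover have "(A - lam j \<cdot>\<^sub>m 1\<^sub>m n) *\<^sub>v eta j + B2 *\<^sub>v xi j \<in> carrier_vec n"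
      using mult_mat_vec_carrier[OF Al eta[OF j]] mult_mat_vec_carrier[OF B2 xi[OF j]] by simp
    ultimately have "(A - lam j \<cdot>\<^sub>m 1\<^sub>m n) *\<^sub>v eta j + B2 *\<^sub>v xi j = 0\<^sub>v n"
      and 2: "C1 *\<^sub>v eta j + D12 *\<^sub>v xi j = 0\<^sub>v p1"
      by (simp_all add: append_vec_eq[of _ n])
    moreover have "(A - lam j \<cdot>\<^sub>m 1\<^sub>m n) *\<^sub>v eta j = A *\<^sub>v eta j - lam j \<cdot>\<^sub>v eta j"
      using eta[OF j] A by (simp add: minus_mult_distrib_mat_vec[of _ n n] smult_one_mult_vec)
    ultimately show "(A *\<^sub>v eta j - lam j \<cdot>\<^sub>v eta j) + B2 *\<^sub>v xi j = 0\<^sub>v n"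
      "C1 *\<^sub>v eta j + D12 *\<^sub>v xi j = 0\<^sub>v p1" by simp_all
  qed
  have col_H: "col Hhat j = eta j" and col_R: "col Rhat j = xi j" if "j < r" for j
    using that eta xi by (simp_all add: Hhat Rhat)
  \<comment> \<open>Column \<open>j\<close> of \<open>Hhat\<close> and of \<open>Rhat\<close> is
    \<open>eta j\<close> and \<open>xi j\<close>, so the null vector equations, read column by
    column, become the matrix equations \<open>AH\<close> and \<open>CH\<close>.\<close>
  have entry: "(M * Hhat + N * Rhat) $$ (i, j) = (M *\<^sub>v eta j) $ i + (N *\<^sub>v xi j) $ i"
    if "M \<in> carrier_mat l n" "N \<in> carrier_mat l m2" "i < l" "j < r" for M N l i j
    using that H R by (simp add: col_H col_R)
  have AH: "A * Hhat + B2 * Rhat = Hhat * mat_diag r lam"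
  proof (rule eq_matI)
    fix i j assume "i < dim_row (Hhat * mat_diag r lam)" "j < dim_col (Hhat * mat_diag r lam)"
    then have ij: "i < n" "j < r" using H by (simp_all add: mat_diag_def)
    have "((A *\<^sub>v eta j - lam j \<cdot>\<^sub>v eta j) + B2 *\<^sub>v xi j) $ i = 0"
      using null_eq(1)[OF ij(2)] ij by simp
    then have "(A *\<^sub>v eta j) $ i - lam j * eta j $ i + (B2 *\<^sub>v xi j) $ i = 0"
      using ij A B2 eta[OF ij(2)] by (simp del: index_mult_mat_vec)
    moreover have "Hhat $$ (i, j) = eta j $ i"
      using col_H[OF ij(2)] H ij by (metis carrier_matD index_col)
    ultimately show "(A * Hhat + B2 * Rhat) $$ (i, j) = (Hhat * mat_diag r lam) $$ (i, j)"
      unfolding entry[OF A B2 ij] mat_diag_mult_right[OF H] using ij by (simp add: mult.commute del: index_mult_mat_vec)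
  qed (use B2 H R in \<open>simp_all add: mat_diag_def\<close>)
  have CH: "C1 * Hhat + D12 * Rhat = 0\<^sub>m p1 r"
  proof (rule eq_matI)
    fix i j assume "i < dim_row (0\<^sub>m p1 r)" "j < dim_col (0\<^sub>m p1 r)"
    then have ij: "i < p1" "j < r" by simp_all
    have "(C1 *\<^sub>v eta j + D12 *\<^sub>v xi j) $ i = 0" using null_eq(2)[OF ij(2)] ij by simp
    then show "(C1 * Hhat + D12 * Rhat) $$ (i, j) = 0\<^sub>m p1 r $$ (i, j)"
      unfolding entry[OF C1 D12 ij] using ij C1 D12 by (simp del: index_mult_mat_vec)
  qed (use D12 R in simp_all)
  \<comment> \<open>A real zero with \<open>lam j = 0\<close> would lie on the imaginary axis, so
    nonpositive becomes negative.\<close>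
  have neg: "lam j < 0" if "j < r" for j
    using nonpos[OF that] zeros[OF that] no_imaginary[of 0] by (cases "lam j = 0") auto
  interpret zero_deflation n m1 m2 p1 r "n - r" A B1 B2 C1 D11 D12 Hhat J P E Rhat
      At12 At22 Bt11 Bt12 Bt21 Bt22 Ct12 lam
    by unfold_locales
      (fact A B1 B2 C1 D11 D12 H J P E R At Bt1 Bt2 Ct HP_JE blocks AH CH AJ CJ B1_split B2_split neg)+
  have K_eq: "K = Rhat * P + Kt * E"
    unfolding K S_def[symmetric] S_split by (rule append_cols_mult_append_rows[OF R Kt(1) P E])
  have "hurwitz (At22 + Bt22 * Kt)" using Kt(2) by (simp add: has_performance_index_def)
  from lmi_optimal_value_eq[OF Kt(1) this]
  have "lmi_optimal_value A B1 B2 C1 D11 D12 = ereal gammat" by (simp add: gammat)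
  then show ?thesis
    using gain_carrier[OF Kt(1) K_eq] performance_index_closed_loop[OF Kt(1) K_eq Kt(2)] by blast
qed

end
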